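(* The smallest order of a ring that is duo and not reflexive is $16$. Moreover, up to isomorphism, the complete list of nonreflexive duo rings of order $16$ is: (i) $\dfrac{\mathbb{F}_2\langle u,v\rangle}{\langle u^3,\,v^3,\,vu,\,u^2-uv,\,v^2-uv\rangle}$; (ii) $\dfrac{\mathbb{Z}_4\langle u,v\rangle}{\langle u^3,\,v^3,\,vu,\,u^2-uv,\,v^2-uv,\,2-uv,\,2u,\,2v\rangle}$.
   Context: All rings are associative with unity. A ring $R$ is right duo if $ba\in aR$ for all $a,b\in R$ (every right ideal is two-sided), left duo if $ba\in Rb$ for all $a,b\in R$, and duo if it is both right and left duo. A ring $R$ is reflexive if for all $a,b\in R$, $aRb=0$ implies $bRa=0$. For a commutative ring $A$, $A\langle u,v\rangle$ denotes the free (noncommutative) associative unital $A$-algebra on $u,v$, and $\langle\cdots\rangle$ in a denominator denotes the two-sided ideal generated by the listed elements. $\mathbb{Z}_4=\mathbb{Z}/4\mathbb{Z}$. A minimal ring of a given type is a ring of that type of smallest possible order (cardinality). *)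

theory Defs
  imports "HOL-Algebra.Algebra" "HOL-Number_Theory.Residues"
begin

definition right_duo :: "('a, 'b) ring_scheme \<Rightarrow> bool" where
  "right_duo R \<longleftrightarrow> (\<forall>a\<in>carrier R. \<forall>b\<in>carrier R. b \<otimes>\<^bsub>R\<^esub> a \<in> a <#\<^bsub>R\<^esub> carrier R)"

definition left_duo :: "('a, 'b) ring_scheme \<Rightarrow> bool" where
  "left_duo R \<longleftrightarrow> (\<forall>a\<in>carrier R. \<forall>b\<in>carrier R. b \<otimes>\<^bsub>R\<^esub> a \<in> carrier R #>\<^bsub>R\<^esub> b)"

definition duo_ring :: "('a, 'b) ring_scheme \<Rightarrow> bool" where
  "duo_ring R \<longleftrightarrow> ring R \<and> right_duo R \<and> left_duo R"

definition reflexive_ring :: "('a, 'b) ring_scheme \<Rightarrow> bool" where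
  "reflexive_ring R \<longleftrightarrow> ring R \<and>
     (\<forall>a\<in>carrier R. \<forall>b\<in>carrier R.
        (\<forall>r\<in>carrier R. a \<otimes>\<^bsub>R\<^esub> r \<otimes>\<^bsub>R\<^esub> b = \<zero>\<^bsub>R\<^esub>) \<longrightarrow>
        (\<forall>r\<in>carrier R. b \<otimes>\<^bsub>R\<^esub> r \<otimes>\<^bsub>R\<^esub> a = \<zero>\<^bsub>R\<^esub>))"

text \<open>The free associative unital algebra over a ring \<open>A\<close> on generators of type \<open>'x\<close>:
  an element is the finitely supported function sending each word to its coefficient, and the
  product is convolution along the factorisations of a word as a concatenation of two words.\<close>

definition free_algebra :: "('a, 'b) ring_scheme \<Rightarrow> ('x list \<Rightarrow> 'a) ring" where
  "free_algebra A =
    \<lparr>carrier = {f. (\<forall>w. f w \<in> carrier A) \<and> finite {w. f w \<noteq> \<zero>\<^bsub>A\<^esub>}},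
     monoid.mult = \<lambda>f g w. (\<Oplus>\<^bsub>A\<^esub>i\<in>{..length w}. f (take i w) \<otimes>\<^bsub>A\<^esub> g (drop i w)),
     monoid.one = \<lambda>w. if w = [] then \<one>\<^bsub>A\<^esub> else \<zero>\<^bsub>A\<^esub>,
     ring.zero = \<lambda>w. \<zero>\<^bsub>A\<^esub>,
     ring.add = \<lambda>f g w. f w \<oplus>\<^bsub>A\<^esub> g w\<rparr>"

definition fa_const :: "('a, 'b) ring_scheme \<Rightarrow> 'a \<Rightarrow> 'x list \<Rightarrow> 'a" where
  "fa_const A c = (\<lambda>w. if w = [] then c else \<zero>\<^bsub>A\<^esub>)"

definition fa_gen :: "('a, 'b) ring_scheme \<Rightarrow> 'x \<Rightarrow> 'x list \<Rightarrow> 'a" where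
  "fa_gen A x = (\<lambda>w. if w = [x] then \<one>\<^bsub>A\<^esub> else \<zero>\<^bsub>A\<^esub>)"

datatype gen = U | V

definition ring_i :: "(gen list \<Rightarrow> int) set ring" where
  "ring_i =
    (let F = free_algebra (residue_ring 2);
         u = fa_gen (residue_ring 2) U;
         v = fa_gen (residue_ring 2) V
     in F Quot (Idl\<^bsub>F\<^esub>
          {u [^]\<^bsub>F\<^esub> (3::nat),
           v [^]\<^bsub>F\<^esub> (3::nat),
           v \<otimes>\<^bsub>F\<^esub> u,
           u [^]\<^bsub>F\<^esub> (2::nat) \<ominus>\<^bsub>F\<^esub> u \<otimes>\<^bsub>F\<^esub> v,
           v [^]\<^bsub>F\<^esub> (2::nat) \<ominus>\<^bsub>F\<^esub> u \<otimes>\<^bsub>F\<^esub> v}))"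

definition ring_ii :: "(gen list \<Rightarrow> int) set ring" where
  "ring_ii =
    (let F = free_algebra (residue_ring 4);
         u = fa_gen (residue_ring 4) U;
         v = fa_gen (residue_ring 4) V;
         two = fa_const (residue_ring 4) 2
     in F Quot (Idl\<^bsub>F\<^esub>
          {u [^]\<^bsub>F\<^esub> (3::nat),
           v [^]\<^bsub>F\<^esub> (3::nat),
           v \<otimes>\<^bsub>F\<^esub> u,
           u [^]\<^bsub>F\<^esub> (2::nat) \<ominus>\<^bsub>F\<^esub> u \<otimes>\<^bsub>F\<^esub> v,
           v [^]\<^bsub>F\<^esub> (2::nat) \<ominus>\<^bsub>F\<^esub> u \<otimes>\<^bsub>F\<^esub> v,
           two \<ominus>\<^bsub>F\<^esub> u \<otimes>\<^bsub>F\<^esub> v,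
           two \<otimes>\<^bsub>F\<^esub> u,
           two \<otimes>\<^bsub>F\<^esub> v}))"

end

theory Submission
  imports Defs
begin

text \<open>
  In a finite duo ring that is not reflexive there are \<open>a\<close>, \<open>b\<close> with \<open>ab = 0 \<noteq> ba\<close>: the duo condition
  moves the middle factor of \<open>bra \<noteq> 0\<close> to the right of \<open>a\<close>. Idempotents of a duo ring are central, so
  splitting off idempotent powers of \<open>a\<close> and \<open>b\<close> makes both nilpotent. Then a relation
  \<open>n + ia + jb + k(ba) = 0\<close> with all coefficients in \<open>{-1, 0, 1}\<close> is trivial, so the sixteen
  combinations with coefficients in \<open>{0, 1}\<close> are distinct. If they exhaust the ring, then
  comparing coefficients forces \<open>a\<^sup>2 = b\<^sup>2 = ba\<close> (one-sided duo conditions exclude squares equal to \<open>0\<close>)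
  and \<open>2 = c(ba)\<close> with \<open>c \<in> {0, 1}\<close>, which determines the ring up to isomorphism. The two quotients
  of free algebras satisfy these relations with \<open>a = v\<close>, \<open>b = u\<close> and \<open>c = 0\<close> or \<open>c = 1\<close>; that \<open>uv\<close> survives
  in the quotient is seen from an explicit ideal cut out by coefficients of words of length at most two.
\<close>

section \<open>Combinations of a zero product\<close>

text \<open>Otherwise \<open>[n] \<cdot> x\<close> also parses as an ideal product with a singleton list.\<close>
no_notation ideal_prod (infixl "\<cdot>\<index>" 80)

definition nilp :: "('a, 'm) ring_scheme \<Rightarrow> 'a \<Rightarrow> bool" where
  "nilp R x \<longleftrightarrow> (\<exists>m::nat. x [^]\<^bsub>R\<^esub> m = \<zero>\<^bsub>R\<^esub>)"

text \<open>The coefficients are integers rather than residues, so one notation serves every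
  characteristic and can be carried from one ring to another.\<close>

definition comb :: "('a, 'm) ring_scheme \<Rightarrow> 'a \<Rightarrow> 'a \<Rightarrow> int \<Rightarrow> int \<Rightarrow> int \<Rightarrow> int \<Rightarrow> 'a" where
  "comb R a b n i j k =
     [n] \<cdot>\<^bsub>R\<^esub> \<one>\<^bsub>R\<^esub> \<oplus>\<^bsub>R\<^esub> [i] \<cdot>\<^bsub>R\<^esub> a \<oplus>\<^bsub>R\<^esub> [j] \<cdot>\<^bsub>R\<^esub> b \<oplus>\<^bsub>R\<^esub> [k] \<cdot>\<^bsub>R\<^esub> (b \<otimes>\<^bsub>R\<^esub> a)"

section \<open>Nilpotent elements and absorption\<close>

lemma (in ring) nilp_mult_commuting:
  assumes "nilp R a" "a \<otimes> t = t \<otimes> a" "a \<in> carrier R" "t \<in> carrier R"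
  shows "nilp R (a \<otimes> t)"
proof -
  obtain m :: nat where "a [^] m = \<zero>" using assms(1) by (auto simp: nilp_def)
  then have "(a \<otimes> t) [^] m = \<zero>"
    using assms by (simp add: pow_mult_distrib)
  then show ?thesis by (auto simp: nilp_def)
qed

text \<open>Iterating the equation gives \<open>x = x \<otimes> z [^] m\<close> for every
  \<open>m\<close>. Many contradictions below exhibit a nonzero element that absorbs a nilpotent
  factor.\<close>

lemma (in ring) right_absorb_nilp:
  assumes "x = x \<otimes> z" "nilp R z" "x \<in> carrier R" "z \<in> carrier R"
  shows "x = \<zero>"
proof -
  have *: "x = x \<otimes> z [^] m" for m :: nat
  proof (induction m)
    case (Suc m)
    have "x \<otimes> z [^] Suc m = (x \<otimes> z [^] m) \<otimes> z"
      using assms by (simp add: m_assoc)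
    then show ?case using Suc assms(1) by simp
  qed (use assms in simp)
  obtain m :: nat where "z [^] m = \<zero>" using assms(2) by (auto simp: nilp_def)
  then show ?thesis using *[of m] assms by simp
qed

lemma (in ring) left_absorb_nilp:
  assumes "x = z \<otimes> x" "nilp R z" "x \<in> carrier R" "z \<in> carrier R"
  shows "x = \<zero>"
proof -
  have *: "x = z [^] m \<otimes> x" for m :: nat
  proof (induction m)
    case (Suc m)
    have "z [^] Suc m \<otimes> x = z [^] m \<otimes> (z \<otimes> x)"
      using assms by (simp add: m_assoc)
    then show ?case using Suc assms(1) by simp
  qed (use assms in simp)
  obtain m :: nat where "z [^] m = \<zero>" using assms(2) by (auto simp: nilp_def)
  then show ?thesis using *[of m] assms by simp
qed

context ring
begin

text \<open>Turns an integer multiple into a product, so that facts about commuting factors apply to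
  it.\<close>

lemma int_multiple_eq:
  assumes "a \<in> carrier R"
  shows "[(i::int)] \<cdot> a = a \<otimes> ([i] \<cdot> \<one>)" "[(i::int)] \<cdot> a = ([i] \<cdot> \<one>) \<otimes> a"
  using assms by (simp_all add: add_pow_ldistr_int add_pow_rdistr_int)

lemma nilp_int_multiple:
  assumes "nilp R a" "a \<in> carrier R"
  shows "nilp R ([(i::int)] \<cdot> a)"
proof -
  have "a \<otimes> ([i] \<cdot> \<one>) = ([i] \<cdot> \<one>) \<otimes> a"
    using int_multiple_eq[OF assms(2), of i] by (rule trans[OF sym])
  from nilp_mult_commuting[OF assms(1) this] show ?thesis
    unfolding int_multiple_eq(1)[OF assms(2), of i] using assms(2) by simp
qed

lemma int_multiple_0 [simp]: "[(0::int)] \<cdot> a = \<zero>"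
  by (simp add: add_pow_def)

lemma comb_closed [simp]:
  "a \<in> carrier R \<Longrightarrow> b \<in> carrier R \<Longrightarrow> comb R a b n i j k \<in> carrier R"
  by (simp add: comb_def)

lemma comb_add:
  assumes "a \<in> carrier R" "b \<in> carrier R"
  shows "comb R a b n i j k \<oplus> comb R a b n' i' j' k' = comb R a b (n + n') (i + i') (j + j') (k + k')"
  using assms by (simp add: comb_def add.int_pow_mult a_ac)

lemma comb_scale:
  assumes "a \<in> carrier R" "b \<in> carrier R"
  shows "[(m::int)] \<cdot> comb R a b n i j k = comb R a b (m * n) (m * i) (m * j) (m * k)"
  using assms by (simp add: comb_def add.int_pow_distrib add.int_pow_pow mult.commute)

lemma comb_uminus:
  assumes "a \<in> carrier R" "b \<in> carrier R"
  shows "\<ominus> comb R a b n i j k = comb R a b (- n) (- i) (- j) (- k)"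
  using assms by (simp add: comb_def add.int_pow_neg minus_add)

lemma comb_minus:
  assumes "a \<in> carrier R" "b \<in> carrier R"
  shows "comb R a b n i j k \<ominus> comb R a b n' i' j' k' = comb R a b (n - n') (i - i') (j - j') (k - k')"
  using assms by (simp add: a_minus_def comb_uminus comb_add)

end

section \<open>Products that vanish in one order only\<close>

locale zero_prod = ring R for R (structure) +
  fixes a b
  assumes a_closed [simp, intro]: "a \<in> carrier R"
    and b_closed [simp, intro]: "b \<in> carrier R"
    and ab [simp]: "a \<otimes> b = \<zero>"
    and ba: "b \<otimes> a \<noteq> \<zero>"
begin

lemma a_nonzero: "a \<noteq> \<zero>" and b_nonzero: "b \<noteq> \<zero>"
  using ba by auto

lemma a_mult_ba [simp]: "a \<otimes> (b \<otimes> a) = \<zero>" and ba_mult_b [simp]: "b \<otimes> a \<otimes> b = \<zero>"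
  by (simp_all add: m_assoc[symmetric], simp add: m_assoc)

text \<open>Left multiplication by \<open>a\<close> kills the terms in \<open>b\<close> and
  \<open>ba\<close>; this and its mirror image \<open>comb_mult_b\<close> isolate two coefficients
  at a time.\<close>

lemma a_mult_comb: "a \<otimes> comb R a b n i j k = [n] \<cdot> a \<oplus> [i] \<cdot> (a \<otimes> a)"
  by (simp add: comb_def r_distr add_pow_rdistr_int)

lemma comb_mult_b: "comb R a b n i j k \<otimes> b = [n] \<cdot> b \<oplus> [j] \<cdot> (b \<otimes> b)"
  by (simp add: comb_def l_distr add_pow_ldistr_int)

end

text \<open>Multiplying a relation by one of its nonzero coefficients in \<open>{-1, 0, 1}\<close>
  thus normalises that coefficient to \<open>1\<close>.\<close>

lemma square_eq_one_of_abs_le_one: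
  fixes n :: int assumes "\<bar>n\<bar> \<le> 1" "n \<noteq> 0" shows "n * n = 1"
proof -
  have "n = 1 \<or> n = -1" using assms by auto
  then show ?thesis by auto
qed

section \<open>Independence of the sixteen combinations\<close>

locale nilpotent_zero_prod = zero_prod +
  assumes nilp_a: "nilp R a" and nilp_b: "nilp R b"
begin

text \<open>The coefficients are eliminated in the order \<open>n\<close>, \<open>i\<close>,
  \<open>j\<close>, \<open>k\<close>, each after being normalised to \<open>1\<close>. The bound is
  the one satisfied by differences of two bits.\<close>

lemma comb_eq_zero_small:
  assumes zero: "comb R a b n i j k = \<zero>"
    and small: "\<bar>n\<bar> \<le> 1" "\<bar>i\<bar> \<le> 1" "\<bar>j\<bar> \<le> 1" "\<bar>k\<bar> \<le> 1"
  shows "n = 0 \<and> i = 0 \<and> j = 0 \<and> k = 0"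
proof -
  have n: "n = 0"
  proof (rule ccontr)
    assume "n \<noteq> 0"
    then have nn: "n * n = 1" using small(1) square_eq_one_of_abs_le_one by blast
    have "comb R a b (n * n) (n * i) (n * j) (n * k) = \<zero>"
      using comb_scale[of a b n n i j k] unfolding zero by simp
    \<comment> \<open>Multiplying by \<open>a\<close> on the left leaves \<open>a\<close> equal to
      itself times a multiple of the nilpotent \<open>a\<close>.\<close>
    then have "a \<otimes> comb R a b (n * n) (n * i) (n * j) (n * k) = \<zero>" by simp
    then have "a \<oplus> [(n * i)] \<cdot> (a \<otimes> a) = \<zero>"
      by (simp add: a_mult_comb nn)
    then have "a = \<ominus> ([(n * i)] \<cdot> (a \<otimes> a))"
      by (intro minus_equality[symmetric]) simp_all
    also have "\<dots> = a \<otimes> ([(- (n * i))] \<cdot> a)"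
      using add_pow_rdistr_int[of a a "- (n * i)"] add.int_pow_neg[of "a \<otimes> a" "n * i"] by simp
    finally show False
      using right_absorb_nilp nilp_int_multiple nilp_a a_nonzero by (meson a_closed add.int_pow_closed)
  qed
  have i: "i = 0"
  proof (rule ccontr)
    assume "i \<noteq> 0"
    then have ii: "i * i = 1" using small(2) square_eq_one_of_abs_le_one by blast
    \<comment> \<open>The signs of \<open>J\<close> and \<open>K\<close> solve the normalised
      relation for \<open>a\<close>, as \<open>a = Jb + K(ba)\<close>.\<close>
    define J where "J = - (i * j)"
    define K where "K = - (i * k)"
    have "comb R a b 0 1 (- J) (- K) = \<zero>"
      using comb_scale[of a b i n i j k] unfolding zero by (simp add: ii n J_def K_def)
    then have "comb R a b 0 1 (- J) (- K) \<oplus> comb R a b 0 0 J K = comb R a b 0 0 J K" by simp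
    then have a: "a = [J] \<cdot> b \<oplus> [K] \<cdot> (b \<otimes> a)"
      unfolding comb_add[OF a_closed b_closed] by (simp add: comb_def)
    \<comment> \<open>Right multiplication by \<open>b\<close> kills both \<open>a\<close> and the
      \<open>ba\<close> term, so a nonzero \<open>J\<close> will force
      \<open>b \<otimes> b = \<zero>\<close>.\<close>
    have "a \<otimes> b = [J] \<cdot> (b \<otimes> b)"
      by (subst a) (simp add: l_distr add_pow_ldistr_int)
    then have Jbb: "[J] \<cdot> (b \<otimes> b) = \<zero>" by simp
    show False
    proof (cases "J = 0")
      case True
      then have "a = [K] \<cdot> b \<otimes> a" using a by (simp add: add_pow_ldistr_int)
      then show False
        using left_absorb_nilp nilp_int_multiple nilp_b a_nonzero by (meson a_closed b_closed add.int_pow_closed)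
    next
      case False
      have "\<bar>J\<bar> \<le> 1" using small by (auto simp: J_def abs_mult mult_le_one)
      then have "J * J = 1" using False square_eq_one_of_abs_le_one by blast
      then have bb: "b \<otimes> b = \<zero>"
        using arg_cong[OF Jbb, of "\<lambda>x. [J] \<cdot> x"] by (simp add: add.int_pow_pow)
      \<comment> \<open>Substituting for \<open>a\<close> on the right puts a factor
        \<open>b \<otimes> b\<close> into both terms.\<close>
      have "b \<otimes> a = [J] \<cdot> (b \<otimes> b) \<oplus> [K] \<cdot> (b \<otimes> b \<otimes> a)"
        by (subst a) (simp add: r_distr add_pow_rdistr_int m_assoc)
      then show False using bb ba by simp
    qed
  qed
  have j: "j = 0"
  proof (rule ccontr)
    assume "j \<noteq> 0"
    then have jj: "j * j = 1" using small(3) square_eq_one_of_abs_le_one by blast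
    have "comb R a b 0 0 1 (j * k) = \<zero>"
      using comb_scale[of a b j n i j k] unfolding zero by (simp add: jj n i)
    then have "comb R a b 0 0 1 (j * k) \<oplus> comb R a b 0 0 0 (- (j * k)) = comb R a b 0 0 0 (- (j * k))" by simp
    then have "b = [(- (j * k))] \<cdot> (b \<otimes> a)"
      unfolding comb_add[OF a_closed b_closed] by (simp add: comb_def)
    then have "b = b \<otimes> ([(- (j * k))] \<cdot> a)" by (simp add: add_pow_rdistr_int)
    then show False
      using right_absorb_nilp nilp_int_multiple nilp_a b_nonzero by (meson a_closed b_closed add.int_pow_closed)
  qed
  have k: "k = 0"
  proof (rule ccontr)
    assume "k \<noteq> 0"
    then have "k * k = 1" using small(4) square_eq_one_of_abs_le_one by blast
    then have "comb R a b 0 0 0 1 = \<zero>"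
      using comb_scale[of a b k n i j k] unfolding zero by (simp add: n i j)
    then show False using ba by (simp add: comb_def)
  qed
  show ?thesis using n i j k by simp
qed

lemma comb_inj_bits:
  assumes "comb R a b n i j k = comb R a b n' i' j' k'"
    and "{n, i, j, k, n', i', j', k'} \<subseteq> {0..1}"
  shows "n = n' \<and> i = i' \<and> j = j' \<and> k = k'"
proof -
  have "comb R a b (n - n') (i - i') (j - j') (k - k') = \<zero>"
    using assms(1) by (simp add: comb_minus[symmetric] r_right_minus_eq)
  moreover have "\<bar>x - y\<bar> \<le> 1" if "x \<in> {0..1}" "y \<in> {0..1}" for x y :: int
    using that by (simp add: abs_le_iff)
  ultimately have "n - n' = 0 \<and> i - i' = 0 \<and> j - j' = 0 \<and> k - k' = 0"
    using assms(2) by (intro comb_eq_zero_small) simp_all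
  then show ?thesis by simp
qed

definition bit_combs :: "'a set" where
  "bit_combs = (\<lambda>(n, i, j, k). comb R a b n i j k) ` ({0..1} \<times> {0..1} \<times> {0..1} \<times> {0..1})"

lemma card_bit_combs: "card bit_combs = 16"
proof -
  have "inj_on (\<lambda>(n, i, j, k). comb R a b n i j k) ({0..1} \<times> {0..1} \<times> {0..1} \<times> {0..1})"
  proof (rule inj_onI)
    fix p q :: "int \<times> int \<times> int \<times> int"
    assume p: "p \<in> {0..1} \<times> {0..1} \<times> {0..1} \<times> {0..1}" and q: "q \<in> {0..1} \<times> {0..1} \<times> {0..1} \<times> {0..1}"
      and eq: "(\<lambda>(n, i, j, k). comb R a b n i j k) p = (\<lambda>(n, i, j, k). comb R a b n i j k) q"
    obtain n i j k n' i' j' k' where pq: "p = (n, i, j, k)" "q = (n', i', j', k')"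
      by (metis prod_cases4)
    from p q have "{n, i, j, k, n', i', j', k'} \<subseteq> {0..1}" unfolding pq by simp
    with comb_inj_bits eq show "p = q" unfolding pq by simp
  qed
  then show ?thesis unfolding bit_combs_def by (subst card_image) (auto simp: card_cartesian_product)
qed

lemma bit_combs_subset: "bit_combs \<subseteq> carrier R"
  by (auto simp: bit_combs_def)

end

section \<open>Duo rings of order 16\<close>

locale duo_zero_prod_16 = nilpotent_zero_prod +
  assumes right_duo: "right_duo R" and left_duo: "left_duo R" and order: "order R = 16"
begin

lemma carrier_eq_bit_combs: "carrier R = bit_combs"
proof (rule card_subset_eq[symmetric])
  show "finite (carrier R)"
    using order by (intro card_ge_0_finite) (simp add: order_def)
qed (use order card_bit_combs bit_combs_subset in \<open>simp_all add: order_def\<close>)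

lemma bit_comb_cases:
  assumes "x \<in> carrier R"
  obtains n i j k where "x = comb R a b n i j k" "{n, i, j, k} \<subseteq> {0..1}"
  using assms unfolding carrier_eq_bit_combs bit_combs_def by auto

lemma comb_bit_nonzero:
  assumes "comb R a b n i j k = \<zero>" "{n, i, j, k} \<subseteq> {0..1}"
  shows "n = 0 \<and> i = 0 \<and> j = 0 \<and> k = 0"
proof -
  have "\<bar>x\<bar> \<le> 1" if "x \<in> {0..1}" for x :: int
    using that by (simp add: abs_le_iff)
  then show ?thesis using assms by (intro comb_eq_zero_small) simp_all
qed

text \<open>Expand \<open>a \<otimes> a\<close> in bits. Absorption excludes \<open>n\<close> and
  \<open>i\<close>, vanishing of the cube of \<open>a\<close> then excludes \<open>j\<close>, and
  right duo excludes \<open>k = 0\<close>.\<close>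

lemma a_square: "a \<otimes> a = b \<otimes> a"
proof -
  obtain n i j k where aa: "a \<otimes> a = comb R a b n i j k" and bits: "{n, i, j, k} \<subseteq> {0..1}"
    using bit_comb_cases[of "a \<otimes> a"] by blast
  have aaa: "a \<otimes> (a \<otimes> a) = [n] \<cdot> a \<oplus> [i] \<cdot> (a \<otimes> a)"
    by (subst aa) (rule a_mult_comb)
  have n: "n = 0"
  proof (rule ccontr)
    assume "n \<noteq> 0"
    then have "n = 1" using bits by auto
    then have "a \<otimes> (a \<otimes> a) = a \<oplus> [i] \<cdot> (a \<otimes> a)" using aaa by simp
    \<comment> \<open>Solving for \<open>a\<close> shows that it absorbs \<open>a(a - i)\<close>,
      which is nilpotent because its factors commute.\<close>
    then have "a = a \<otimes> (a \<otimes> a) \<ominus> [i] \<cdot> (a \<otimes> a)"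
      by (simp add: a_minus_def a_assoc r_neg)
    also have "\<dots> = a \<otimes> (a \<otimes> (a \<ominus> [i] \<cdot> \<one>))"
      by (simp add: a_minus_def r_distr r_minus add_pow_rdistr_int)
    finally have *: "a = a \<otimes> (a \<otimes> (a \<ominus> [i] \<cdot> \<one>))" .
    have "a \<otimes> (a \<ominus> [i] \<cdot> \<one>) = (a \<ominus> [i] \<cdot> \<one>) \<otimes> a"
      by (simp add: a_minus_def r_distr l_distr l_minus r_minus add_pow_rdistr_int add_pow_ldistr_int)
    then have "nilp R (a \<otimes> (a \<ominus> [i] \<cdot> \<one>))" using nilp_a by (intro nilp_mult_commuting) auto
    then show False using right_absorb_nilp[OF *] a_nonzero by simp
  qed
  have i: "i = 0"
  proof (rule ccontr)
    assume "i \<noteq> 0"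
    then have i: "i = 1" using bits by auto
    have "a \<otimes> a = a \<otimes> a \<otimes> a" using aaa by (simp add: n i m_assoc)
    then have "a \<otimes> a = \<zero>" using right_absorb_nilp nilp_a by simp
    then show False using comb_bit_nonzero[of n i j k] aa bits i by simp
  qed
  have aaa: "a \<otimes> (a \<otimes> a) = \<zero>" using aaa by (simp add: n i)
  have aa': "a \<otimes> a = [j] \<cdot> b \<oplus> [k] \<cdot> (b \<otimes> a)" using aa by (simp add: n i comb_def)
  have j: "j = 0"
  proof (rule ccontr)
    assume "j \<noteq> 0"
    then have "j = 1" using bits by auto
    \<comment> \<open>One multiplication by \<open>a\<close> gives a relation for \<open>ba\<close>;
      a second one shows that its other term is zero.\<close>
    then have "(a \<otimes> a) \<otimes> a = b \<otimes> a \<oplus> [k] \<cdot> (b \<otimes> (a \<otimes> a))"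
      by (subst aa') (simp add: l_distr add_pow_ldistr_int m_assoc)
    then have baa: "\<zero> = b \<otimes> a \<oplus> [k] \<cdot> (b \<otimes> (a \<otimes> a))" using aaa by (simp add: m_assoc)
    have "\<zero> \<otimes> a = b \<otimes> (a \<otimes> a) \<oplus> [k] \<cdot> (b \<otimes> (a \<otimes> (a \<otimes> a)))"
      by (subst baa) (simp add: l_distr add_pow_ldistr_int m_assoc)
    then have z: "b \<otimes> (a \<otimes> a) = \<zero>" by (simp add: aaa)
    show False using baa ba unfolding z by simp
  qed
  have "k \<noteq> 0"
  proof
    assume "k = 0"
    then have aa0: "a \<otimes> a = \<zero>" using aa' by (simp add: j)
    \<comment> \<open>With \<open>a \<otimes> a = \<zero>\<close> the product
      \<open>a \<otimes> r\<close> is a bit multiple of \<open>a\<close>, and uniqueness of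
      coefficients keeps \<open>ba\<close> from being one.\<close>
    obtain r where r: "r \<in> carrier R" "b \<otimes> a = a \<otimes> r"
      using right_duo by (auto simp: right_duo_def l_coset_def)
    then obtain n' i' j' k' where r': "r = comb R a b n' i' j' k'" "{n', i', j', k'} \<subseteq> {0..1}"
      using bit_comb_cases by blast
    have "b \<otimes> a = [n'] \<cdot> a" using r(2) by (simp add: r'(1) a_mult_comb aa0)
    then have "comb R a b 0 0 0 1 = comb R a b 0 n' 0 0" by (simp add: comb_def)
    then show False using comb_inj_bits[of 0 0 0 1 0 n' 0 0] r'(2) by simp
  qed
  then have "k = 1" using bits by auto
  then show ?thesis using aa' j by simp
qed

text \<open>The mirror image of \<open>a_square\<close>: passing to the opposite ring exchanges
  \<open>a\<close> and \<open>b\<close>, keeps the element \<open>ba\<close>, and turns right duo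
  into left duo.\<close>

lemma b_square: "b \<otimes> b = b \<otimes> a"
proof -
  obtain n i j k where bb: "b \<otimes> b = comb R a b n i j k" and bits: "{n, i, j, k} \<subseteq> {0..1}"
    using bit_comb_cases[of "b \<otimes> b"] by blast
  have bbb: "b \<otimes> b \<otimes> b = [n] \<cdot> b \<oplus> [j] \<cdot> (b \<otimes> b)"
    by (subst bb) (rule comb_mult_b)
  have n: "n = 0"
  proof (rule ccontr)
    assume "n \<noteq> 0"
    then have "n = 1" using bits by auto
    then have "b \<otimes> b \<otimes> b = b \<oplus> [j] \<cdot> (b \<otimes> b)" using bbb by simp
    then have "b = b \<otimes> b \<otimes> b \<ominus> [j] \<cdot> (b \<otimes> b)"
      by (simp add: a_minus_def a_assoc r_neg)
    also have "\<dots> = b \<otimes> (b \<ominus> [j] \<cdot> \<one>) \<otimes> b"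
      by (simp add: a_minus_def r_distr r_minus l_distr l_minus add_pow_rdistr_int add_pow_ldistr_int m_assoc)
    finally have *: "b = b \<otimes> (b \<ominus> [j] \<cdot> \<one>) \<otimes> b" .
    have "b \<otimes> (b \<ominus> [j] \<cdot> \<one>) = (b \<ominus> [j] \<cdot> \<one>) \<otimes> b"
      by (simp add: a_minus_def r_distr l_distr l_minus r_minus add_pow_rdistr_int add_pow_ldistr_int)
    then have "nilp R (b \<otimes> (b \<ominus> [j] \<cdot> \<one>))" using nilp_b by (intro nilp_mult_commuting) auto
    then show False using left_absorb_nilp[OF *] b_nonzero by simp
  qed
  have j: "j = 0"
  proof (rule ccontr)
    assume "j \<noteq> 0"
    then have j: "j = 1" using bits by auto
    have "b \<otimes> b = b \<otimes> (b \<otimes> b)" using bbb by (simp add: n j m_assoc)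
    then have "b \<otimes> b = \<zero>" using left_absorb_nilp nilp_b by simp
    then show False using comb_bit_nonzero[of n i j k] bb bits j by simp
  qed
  have bbb: "b \<otimes> (b \<otimes> b) = \<zero>" using bbb by (simp add: n j m_assoc)
  have "b \<otimes> (b \<otimes> (b \<otimes> a)) = b \<otimes> (b \<otimes> b) \<otimes> a" by (simp add: m_assoc)
  then have bbba: "b \<otimes> (b \<otimes> (b \<otimes> a)) = \<zero>" by (simp only: bbb l_null a_closed)
  have bb': "b \<otimes> b = [i] \<cdot> a \<oplus> [k] \<cdot> (b \<otimes> a)" using bb by (simp add: n j comb_def)
  have i: "i = 0"
  proof (rule ccontr)
    assume "i \<noteq> 0"
    then have "i = 1" using bits by auto
    then have "b \<otimes> (b \<otimes> b) = b \<otimes> a \<oplus> [k] \<cdot> (b \<otimes> (b \<otimes> a))"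
      by (subst bb') (simp add: r_distr add_pow_rdistr_int)
    then have bba: "\<zero> = b \<otimes> a \<oplus> [k] \<cdot> (b \<otimes> (b \<otimes> a))" using bbb by simp
    have "b \<otimes> \<zero> = b \<otimes> (b \<otimes> a) \<oplus> [k] \<cdot> (b \<otimes> (b \<otimes> (b \<otimes> a)))"
      by (subst bba) (simp add: r_distr add_pow_rdistr_int)
    then have z: "b \<otimes> (b \<otimes> a) = \<zero>" by (simp add: bbba)
    show False using bba ba unfolding z by simp
  qed
  have "k \<noteq> 0"
  proof
    assume "k = 0"
    then have bb0: "b \<otimes> b = \<zero>" using bb' by (simp add: i)
    obtain r where r: "r \<in> carrier R" "b \<otimes> a = r \<otimes> b"
      using left_duo by (auto simp: left_duo_def r_coset_def)
    then obtain n' i' j' k' where r': "r = comb R a b n' i' j' k'" "{n', i', j', k'} \<subseteq> {0..1}"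
      using bit_comb_cases by blast
    have "b \<otimes> a = [n'] \<cdot> b" using r(2) by (simp add: r'(1) comb_mult_b bb0)
    then have "comb R a b 0 0 0 1 = comb R a b 0 0 n' 0" by (simp add: comb_def)
    then show False using comb_inj_bits[of 0 0 0 1 0 0 n' 0] r'(2) by simp
  qed
  then have "k = 1" using bits by auto
  then show ?thesis using bb' i by simp
qed

lemma ba_multiple_eq_zero:
  assumes "[(k::int)] \<cdot> (b \<otimes> a) = \<zero>" "k \<in> {0..1}"
  shows "k = 0"
  using comb_bit_nonzero[of 0 0 0 k] assms by (simp add: comb_def)

text \<open>The element \<open>\<one> \<oplus> \<one>\<close> is central. Commuting with
  \<open>a\<close> eliminates \<open>j\<close>, then commuting with \<open>b\<close> eliminates
  \<open>i\<close>.\<close>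

lemma two_eq: "\<exists>c\<in>{0..1::int}. \<one> \<oplus> \<one> = [c] \<cdot> (b \<otimes> a)"
proof -
  have "b \<otimes> b \<otimes> b = \<zero>" by (simp only: b_square ba_mult_b)
  then have "b \<otimes> (b \<otimes> b) = \<zero>" by (simp add: m_assoc)
  then have bba: "b \<otimes> (b \<otimes> a) = \<zero>" by (simp only: b_square)
  have "b \<otimes> a \<otimes> a = b \<otimes> b \<otimes> a" by (simp only: b_square)
  then have baa: "b \<otimes> a \<otimes> a = \<zero>" by (simp add: m_assoc bba)
  obtain n i j k where two: "\<one> \<oplus> \<one> = comb R a b n i j k" and bits: "{n, i, j, k} \<subseteq> {0..1}"
    using bit_comb_cases[of "\<one> \<oplus> \<one>"] by blast
  have n: "n = 0"
  proof (rule ccontr)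
    assume "n \<noteq> 0"
    then have n: "n = 1" using bits by auto
    \<comment> \<open>Moving everything to one side leaves constant coefficient \<open>1\<close> and
      all others in \<open>{-1, 0}\<close>, which independence forbids.\<close>
    have "comb R a b 1 0 0 0 \<oplus> comb R a b 1 0 0 0 = comb R a b 1 i j k"
      using two n by (simp add: comb_def)
    then have "comb R a b 2 0 0 0 \<ominus> comb R a b 1 i j k = \<zero>"
      by (simp add: comb_add)
    then have "comb R a b 1 (- i) (- j) (- k) = \<zero>" by (simp add: comb_minus)
    from comb_eq_zero_small[OF this] bits show False by simp
  qed
  have "[i] \<cdot> (b \<otimes> a) \<oplus> [j] \<cdot> (b \<otimes> a) = comb R a b n i j k \<otimes> a"
    by (simp add: n comb_def l_distr add_pow_ldistr_int a_square baa)
  also have "\<dots> = a \<otimes> comb R a b n i j k"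
    by (simp add: two[symmetric] l_distr r_distr)
  also have "\<dots> = [i] \<cdot> (b \<otimes> a)"
    by (simp add: a_mult_comb n a_square)
  finally have "[j] \<cdot> (b \<otimes> a) = \<zero>" by simp
  then have j: "j = 0" using ba_multiple_eq_zero[of j] bits by simp
  have "[i] \<cdot> (b \<otimes> a) = b \<otimes> comb R a b n i j k"
    by (simp add: n j comb_def r_distr add_pow_rdistr_int bba)
  also have "\<dots> = comb R a b n i j k \<otimes> b"
    by (simp add: two[symmetric] l_distr r_distr)
  also have "\<dots> = \<zero>"
    by (simp add: comb_mult_b n j)
  finally have i: "i = 0" using ba_multiple_eq_zero[of i] bits by simp
  show ?thesis using two bits by (intro bexI[of _ k]) (simp_all add: n i j comb_def)
qed

end

section \<open>Rings presented by the relations\<close>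

text \<open>The condition for \<open>n + ia + jb + k(ba) = 0\<close> when \<open>2 = c(ba)\<close>.\<close>
definition comb_null :: "int \<Rightarrow> int \<Rightarrow> int \<Rightarrow> int \<Rightarrow> int \<Rightarrow> bool" where
  "comb_null c n i j k \<longleftrightarrow> even n \<and> even i \<and> even j \<and> even (k + c * (n div 2))"

text \<open>The bit \<open>c\<close> records the characteristic: \<open>2\<close> vanishes for
  \<open>c = 0\<close> and is the nonzero element \<open>ba\<close> for
  \<open>c = 1\<close>.\<close>

locale presented_relations = zero_prod +
  fixes c :: int
  assumes c_bit: "c \<in> {0..1}"
    and a_sq: "a \<otimes> a = b \<otimes> a" and b_sq: "b \<otimes> b = b \<otimes> a"
    and two: "\<one> \<oplus> \<one> = [c] \<cdot> (b \<otimes> a)"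
begin

lemma b_ba [simp]: "b \<otimes> (b \<otimes> a) = \<zero>"
proof -
  have "b \<otimes> b \<otimes> b = \<zero>" by (simp only: b_sq ba_mult_b)
  then have "b \<otimes> (b \<otimes> b) = \<zero>" by (simp add: m_assoc)
  then show ?thesis by (simp only: b_sq)
qed

lemma ba_a [simp]: "b \<otimes> a \<otimes> a = \<zero>"
proof -
  have "b \<otimes> a \<otimes> a = b \<otimes> b \<otimes> a" by (simp only: b_sq)
  then show ?thesis by (simp add: m_assoc)
qed

lemma ba_ba [simp]: "b \<otimes> a \<otimes> (b \<otimes> a) = \<zero>"
  by (simp add: m_assoc)

sublocale nilpotent_zero_prod R a b
proof
  have "a [^] (3::nat) = \<zero>" by (simp add: numeral_3_eq_3 m_assoc a_sq)
  then show "nilp R a" by (auto simp: nilp_def)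
  have "b [^] (3::nat) = \<zero>" by (simp add: numeral_3_eq_3 b_sq)
  then show "nilp R b" by (auto simp: nilp_def)
qed

text \<open>The quadratic products \<open>aa\<close>, \<open>bb\<close> and \<open>ba\<close>
  coincide and cubic ones vanish; the term \<open>i * j'\<close> is absent because
  \<open>ab = 0\<close>.\<close>

lemma comb_mult:
  "comb R a b n i j k \<otimes> comb R a b n' i' j' k' =
   comb R a b (n * n') (n * i' + i * n') (n * j' + j * n') (n * k' + k * n' + i * i' + j * j' + j * i')"
  by (simp add: comb_def l_distr r_distr add_pow_ldistr_int add_pow_rdistr_int add.int_pow_pow
      add.int_pow_distrib add.int_pow_mult a_sq b_sq a_ac mult.commute)

lemma int_multiple_2: "x \<in> carrier R \<Longrightarrow> [(2::int)] \<cdot> x = x \<oplus> x"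
  using add.int_pow_mult[of x 1 1] by simp

lemma double_eq: "x \<in> carrier R \<Longrightarrow> [(2::int)] \<cdot> x = [c] \<cdot> (b \<otimes> a \<otimes> x)"
  using two[THEN arg_cong, of "\<lambda>y. y \<otimes> x"]
  by (simp add: int_multiple_2 l_distr add_pow_ldistr_int)

lemma double_comb:
  "[(2::int)] \<cdot> \<one> = [c] \<cdot> (b \<otimes> a)" "[(2::int)] \<cdot> a = \<zero>" "[(2::int)] \<cdot> b = \<zero>" "[(2::int)] \<cdot> (b \<otimes> a) = \<zero>"
  by (simp_all add: double_eq)

lemma multiple_mod_2:
  assumes "x \<in> carrier R"
  shows "[(n::int)] \<cdot> x = [(n mod 2)] \<cdot> x \<oplus> [(n div 2)] \<cdot> ([(2::int)] \<cdot> x)"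
proof -
  have "[n] \<cdot> x = [(n mod 2 + 2 * (n div 2))] \<cdot> x" by simp
  then show ?thesis using assms by (simp only: add.int_pow_mult add.int_pow_pow)
qed

text \<open>Reducing \<open>n\<close> carries: each \<open>2\<close> removed becomes
  \<open>c\<close> copies of \<open>ba\<close>. The other coefficients reduce without carry because
  \<open>2\<close> annihilates \<open>a\<close>, \<open>b\<close> and \<open>ba\<close>.\<close>

lemma comb_mod:
  "comb R a b n i j k = comb R a b (n mod 2) (i mod 2) (j mod 2) ((k + c * (n div 2)) mod 2)"
proof -
  have n: "[n] \<cdot> \<one> = [(n mod 2)] \<cdot> \<one> \<oplus> [(c * (n div 2))] \<cdot> (b \<otimes> a)"
    using multiple_mod_2[of \<one> n] by (simp add: double_comb add.int_pow_pow)
  have i: "[i] \<cdot> a = [(i mod 2)] \<cdot> a" and j: "[j] \<cdot> b = [(j mod 2)] \<cdot> b"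
    using multiple_mod_2[of a i] multiple_mod_2[of b j] by (simp_all add: double_comb)
  have k: "[(k + c * (n div 2))] \<cdot> (b \<otimes> a) = [((k + c * (n div 2)) mod 2)] \<cdot> (b \<otimes> a)"
    using multiple_mod_2[of "b \<otimes> a" "k + c * (n div 2)"] by (simp add: double_comb)
  have "comb R a b n i j k = [(n mod 2)] \<cdot> \<one> \<oplus> [(i mod 2)] \<cdot> a \<oplus> [(j mod 2)] \<cdot> b \<oplus> [(k + c * (n div 2))] \<cdot> (b \<otimes> a)"
    unfolding comb_def n i[symmetric] j[symmetric] by (simp add: add.int_pow_mult a_ac)
  then show ?thesis unfolding k by (simp add: comb_def)
qed

text \<open>After reduction the coefficients are bits, so independence applies. The criterion
  depends on \<open>c\<close> but not on the ring, which is what allows two rings to be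
  compared.\<close>

lemma comb_eq_zero_iff: "comb R a b n i j k = \<zero> \<longleftrightarrow> comb_null c n i j k"
proof -
  have "comb R a b n i j k = \<zero> \<longleftrightarrow>
      comb R a b (n mod 2) (i mod 2) (j mod 2) ((k + c * (n div 2)) mod 2) = \<zero>"
    by (simp only: comb_mod[of n i j k])
  also have "\<dots> \<longleftrightarrow> n mod 2 = 0 \<and> i mod 2 = 0 \<and> j mod 2 = 0 \<and> (k + c * (n div 2)) mod 2 = 0"
  proof
    assume "comb R a b (n mod 2) (i mod 2) (j mod 2) ((k + c * (n div 2)) mod 2) = \<zero>"
    moreover have "\<bar>x mod 2\<bar> \<le> 1" for x :: int by presburger
    ultimately show "n mod 2 = 0 \<and> i mod 2 = 0 \<and> j mod 2 = 0 \<and> (k + c * (n div 2)) mod 2 = 0"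
      by (intro comb_eq_zero_small)
  qed (simp add: comb_def)
  also have "\<dots> \<longleftrightarrow> comb_null c n i j k"
    by (simp only: comb_null_def even_iff_mod_2_eq_zero)
  finally show ?thesis .
qed

lemma comb_eq_iff:
  "comb R a b n i j k = comb R a b n' i' j' k' \<longleftrightarrow> comb_null c (n - n') (i - i') (j - j') (k - k')"
  by (simp add: comb_eq_zero_iff[symmetric] comb_minus[symmetric])

end

section \<open>Structure and uniqueness of the presented rings\<close>

locale presented = presented_relations +
  assumes span: "x \<in> carrier R \<Longrightarrow> \<exists>n i j k. x = comb R a b n i j k"
begin

lemma carrier_eq_bit_combs: "carrier R = bit_combs"
proof
  show "carrier R \<subseteq> bit_combs"
  proof
    fix x assume "x \<in> carrier R"
    then obtain n i j k where "x = comb R a b n i j k" using span by blast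
    then have "x = comb R a b (n mod 2) (i mod 2) (j mod 2) ((k + c * (n div 2)) mod 2)"
      by (simp only: comb_mod[of n i j k])
    moreover have "z mod 2 \<le> 1" for z :: int by presburger
    ultimately show "x \<in> bit_combs" unfolding bit_combs_def
      by (intro image_eqI[of _ _ "(n mod 2, i mod 2, j mod 2, (k + c * (n div 2)) mod 2)"]) simp_all
  qed
qed (rule bit_combs_subset)

lemma order_16: "order R = 16"
  by (simp add: order_def carrier_eq_bit_combs card_bit_combs)

lemma carrier_cases:
  assumes "x \<in> carrier R"
  obtains n i j k where "x = comb R a b n i j k" "n = 0 \<or> n = 1" "i = 0 \<or> i = 1" "j = 0 \<or> j = 1"
proof -
  obtain n i j k where x: "x = comb R a b n i j k" and "n \<in> {0..1}" "i \<in> {0..1}" "j \<in> {0..1}"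
    using assms unfolding carrier_eq_bit_combs bit_combs_def by auto
  moreover have "z = 0 \<or> z = 1" if "z \<in> {0..1}" for z :: int using that by auto
  ultimately show ?thesis using that by blast
qed

lemma is_duo: "duo_ring R"
  unfolding duo_ring_def right_duo_def left_duo_def
proof (intro conjI ballI ring_axioms)
  fix x y assume "x \<in> carrier R" "y \<in> carrier R"
  obtain n i j k where
    x: "x = comb R a b n i j k" "n = 0 \<or> n = 1" "i = 0 \<or> i = 1" "j = 0 \<or> j = 1"
    using carrier_cases[OF \<open>x \<in> carrier R\<close>] by blast
  obtain n' i' j' k' where
    y: "y = comb R a b n' i' j' k'" "n' = 0 \<or> n' = 1" "i' = 0 \<or> i' = 1" "j' = 0 \<or> j' = 1"
    using carrier_cases[OF \<open>y \<in> carrier R\<close>] by blast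
  \<comment> \<open>The contribution of the \<open>a\<close> and \<open>b\<close> terms to the
    coefficient of \<open>ba\<close> in \<open>y \<otimes> x\<close>.\<close>
  define t where "t = i' * i + j' * j + j' * i"
  have "\<exists>m p q r. y \<otimes> x = x \<otimes> comb R a b m p q r"
  proof (cases "n = 0")
    case True
    \<comment> \<open>Here \<open>t(ba)\<close> must arise as \<open>x\<close> times a multiple of
      \<open>b\<close> if \<open>j = 1\<close>, of \<open>a\<close> if only \<open>i = 1\<close>; if
      both are zero, so is \<open>t\<close>.\<close>
    have "y \<otimes> x = x \<otimes> comb R a b n' (if j = 0 then t else 0) (if j = 0 then 0 else t) 0"
      using x(2-4) True unfolding x(1) y(1) comb_mult by (auto simp: t_def algebra_simps)
    then show ?thesis by blast
  next
    case False
    \<comment> \<open>Now \<open>x\<close> fixes \<open>ba\<close>, so adding the commutator of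
      \<open>y\<close> and \<open>x\<close> to \<open>y\<close> corrects the product.\<close>
    then have "y \<otimes> x = x \<otimes> comb R a b n' i' j' (k' + j' * i - j * i')"
      using x(2) unfolding x(1) y(1) comb_mult by (auto simp: algebra_simps)
    then show ?thesis by blast
  qed
  then show "y \<otimes> x \<in> x <# carrier R" by (auto simp: l_coset_def)
  have "\<exists>m p q r. y \<otimes> x = comb R a b m p q r \<otimes> y"
  proof (cases "n' = 0")
    case True
    have "y \<otimes> x = comb R a b n (if i' = 0 then 0 else t) (if i' = 0 then t else 0) 0 \<otimes> y"
      using y(2-4) True unfolding x(1) y(1) comb_mult by (auto simp: t_def algebra_simps)
    then show ?thesis by blast
  next
    case False
    then have "y \<otimes> x = comb R a b n i j (k + j' * i - j * i') \<otimes> y"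
      using y(2) unfolding x(1) y(1) comb_mult by (auto simp: algebra_simps)
    then show ?thesis by blast
  qed
  then show "y \<otimes> x \<in> carrier R #> y" by (auto simp: r_coset_def)
qed

text \<open>Each \<open>a \<otimes> r\<close> is a combination of \<open>a\<close> and
  \<open>ba\<close>, both killed by \<open>b\<close> on the right, while \<open>ba\<close> itself is
  nonzero.\<close>

lemma not_reflexive: "\<not> reflexive_ring R"
proof
  assume refl: "reflexive_ring R"
  have "a \<otimes> r \<otimes> b = \<zero>" if "r \<in> carrier R" for r
  proof -
    obtain n i j k where r: "r = comb R a b n i j k" using span \<open>r \<in> carrier R\<close> by blast
    show ?thesis unfolding r a_mult_comb a_sq by (simp add: l_distr add_pow_ldistr_int)
  qed
  then have "b \<otimes> \<one> \<otimes> a = \<zero>" using refl unfolding reflexive_ring_def by blast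
  then show False using ba by simp
qed

end

text \<open>Sending a combination to the one with the same coefficients is well defined and
  injective, since equality is the same condition on coefficients in both rings, and it respects the
  common multiplication table.\<close>

lemma presented_ring_iso:
  assumes R: "presented R a b c" and S: "presented S a' b' c"
  shows "R \<simeq> S"
proof -
  interpret R: presented R a b c by fact
  interpret S: presented S a' b' c by fact
  \<comment> \<open>An element has many integer coefficient tuples; the next fact shows that the
    value does not depend on the one selected.\<close>
  define h where "h x = (SOME y. \<exists>n i j k. x = comb R a b n i j k \<and> y = comb S a' b' n i j k)" for x
  have h: "h (comb R a b n i j k) = comb S a' b' n i j k" for n i j k
  proof -
    have "\<exists>n' i' j' k'. comb R a b n i j k = comb R a b n' i' j' k' \<and>
        h (comb R a b n i j k) = comb S a' b' n' i' j' k'"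
      unfolding h_def by (rule someI[of _ "comb S a' b' n i j k"]) blast
    then obtain n' i' j' k' where eq: "comb R a b n i j k = comb R a b n' i' j' k'"
      and hx: "h (comb R a b n i j k) = comb S a' b' n' i' j' k'" by blast
    from eq have "comb S a' b' n i j k = comb S a' b' n' i' j' k'"
      by (simp only: R.comb_eq_iff S.comb_eq_iff)
    then show ?thesis by (simp only: hx)
  qed
  have "h \<in> ring_iso R S"
  proof (rule ring_iso_memI)
    show "bij_betw h (carrier R) (carrier S)"
    proof (rule bij_betwI')
      fix x y assume "x \<in> carrier R" "y \<in> carrier R"
      then obtain n i j k n' i' j' k' where xy: "x = comb R a b n i j k" "y = comb R a b n' i' j' k'"
        using R.span[of x] R.span[of y] by blast
      show "(h x = h y) = (x = y)" unfolding xy h by (simp only: R.comb_eq_iff S.comb_eq_iff)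
    next
      fix y assume "y \<in> carrier S"
      then obtain n i j k where "y = comb S a' b' n i j k" using S.span by blast
      then show "\<exists>x\<in>carrier R. y = h x" by (intro bexI[of _ "comb R a b n i j k"]) (simp_all add: h)
    next
      fix x assume "x \<in> carrier R"
      then obtain n i j k where "x = comb R a b n i j k" using R.span by blast
      then show "h x \<in> carrier S" by (simp add: h)
    qed
  next
    fix x y assume "x \<in> carrier R" "y \<in> carrier R"
    then obtain n i j k n' i' j' k' where xy: "x = comb R a b n i j k" "y = comb R a b n' i' j' k'"
      using R.span[of x] R.span[of y] by blast
    show "h x \<in> carrier S" unfolding xy h by simp
    show "h (x \<otimes>\<^bsub>R\<^esub> y) = h x \<otimes>\<^bsub>S\<^esub> h y" unfolding xy h R.comb_mult S.comb_mult ..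
    show "h (x \<oplus>\<^bsub>R\<^esub> y) = h x \<oplus>\<^bsub>S\<^esub> h y"
      unfolding xy h R.comb_add[OF R.a_closed R.b_closed] S.comb_add[OF S.a_closed S.b_closed] ..
  next
    have "comb R a b 1 0 0 0 = \<one>\<^bsub>R\<^esub>" "comb S a' b' 1 0 0 0 = \<one>\<^bsub>S\<^esub>"
      by (simp_all add: comb_def)
    then show "h \<one>\<^bsub>R\<^esub> = \<one>\<^bsub>S\<^esub>" using h[of 1 0 0 0] by simp
  qed
  then show ?thesis by (auto simp: is_ring_iso_def)
qed

section \<open>Finite nonreflexive duo rings\<close>

text \<open>Powers are periodic with some period \<open>p\<close> from some exponent
  \<open>i\<close> on; an exponent that is at least \<open>i\<close> and divisible by
  \<open>p\<close> gives an idempotent.\<close>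

lemma (in monoid) finite_imp_idempotent_power:
  assumes "finite (carrier G)" "x \<in> carrier G"
  obtains n :: nat where "n > 0" "x [^] n \<otimes> x [^] n = x [^] n"
proof -
  have "\<not> inj (\<lambda>n::nat. x [^] n)"
  proof
    assume "inj (\<lambda>n::nat. x [^] n)"
    moreover have "range (\<lambda>n::nat. x [^] n) \<subseteq> carrier G" using assms by auto
    ultimately show False using assms(1) finite_subset finite_imageD infinite_UNIV_nat by blast
  qed
  then obtain i j :: nat where "x [^] i = x [^] j" "i < j"
    unfolding inj_def by (metis linorder_neqE_nat)
  then obtain p where p: "x [^] (i + p) = x [^] i" "p > 0"
    by (metis less_imp_add_positive)
  have shift: "x [^] (i + d + p) = x [^] (i + d)" for d
  proof -
    have "x [^] (i + d + p) = x [^] (i + p) \<otimes> x [^] d"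
      using assms by (simp add: nat_pow_mult ac_simps)
    then show ?thesis using assms by (simp add: p nat_pow_mult)
  qed
  have shifts: "x [^] (i + d + m * p) = x [^] (i + d)" for d m
  proof (induction m)
    case (Suc m)
    have "x [^] (i + d + Suc m * p) = x [^] (i + (d + m * p) + p)" by (simp add: ac_simps)
    then show ?case using Suc unfolding shift by (simp add: ac_simps)
  qed simp
  \<comment> \<open>The successor keeps the exponent positive when \<open>i = 0\<close>.\<close>
  define n where "n = Suc i * p"
  have "i \<le> n" using p(2) by (cases p) (simp_all add: n_def)
  then have "x [^] (n + Suc i * p) = x [^] n" using shifts[of "n - i" "Suc i"] by simp
  then have "x [^] n \<otimes> x [^] n = x [^] n" using assms by (simp add: nat_pow_mult n_def)
  moreover have "n > 0" using p(2) by (simp add: n_def)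
  ultimately show ?thesis using that by blast
qed

context ring
begin

text \<open>Writing \<open>er = se\<close> and \<open>re = et\<close> shows that both products equal
  \<open>ere\<close>.\<close>

lemma duo_idempotent_central:
  assumes duo: "right_duo R" "left_duo R" and e: "e \<in> carrier R" "e \<otimes> e = e" and r: "r \<in> carrier R"
  shows "e \<otimes> r = r \<otimes> e"
proof -
  obtain s where s: "s \<in> carrier R" "e \<otimes> r = s \<otimes> e"
    using duo(2) e(1) r unfolding left_duo_def r_coset_def by blast
  obtain t where t: "t \<in> carrier R" "r \<otimes> e = e \<otimes> t"
    using duo(1) e(1) r unfolding right_duo_def l_coset_def by blast
  have "e \<otimes> r = e \<otimes> r \<otimes> e" using s e by (simp add: m_assoc)
  also have "\<dots> = e \<otimes> (e \<otimes> t)" using t e r by (simp add: m_assoc)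
  also have "\<dots> = r \<otimes> e" using t e by (simp add: m_assoc[symmetric])
  finally show ?thesis .
qed

text \<open>The nilpotent half of a Fitting decomposition: \<open>f\<close> is the complement of an
  idempotent power of \<open>x\<close> and annihilates that power.\<close>

lemma duo_nilpotent_component:
  assumes duo: "right_duo R" "left_duo R" and fin: "finite (carrier R)" and x: "x \<in> carrier R"
  obtains n :: nat and f where "n > 0" "f = \<one> \<ominus> x [^] n" "\<And>r. r \<in> carrier R \<Longrightarrow> f \<otimes> r = r \<otimes> f"
    "nilp R (f \<otimes> x)"
proof -
  obtain n :: nat where n: "n > 0" and idem: "x [^] n \<otimes> x [^] n = x [^] n"
    using finite_imp_idempotent_power fin x by blast
  define e where "e = x [^] n"
  define f where "f = \<one> \<ominus> e"
  have e: "e \<in> carrier R" "e \<otimes> e = e" using x idem by (simp_all add: e_def)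
  have f: "f \<in> carrier R" using e by (simp add: f_def)
  have fe: "f \<otimes> e = \<zero>" using e by (simp add: f_def a_minus_def l_distr l_minus r_neg)
  have comm: "f \<otimes> r = r \<otimes> f" if "r \<in> carrier R" for r
    using duo_idempotent_central[OF duo e that] e that
    by (simp add: f_def a_minus_def l_distr r_distr l_minus r_minus)
  have "f [^] (n - 1) \<otimes> f = f [^] n"
    using n by (cases n) simp_all
  moreover have "(f \<otimes> x) [^] n = f [^] n \<otimes> x [^] n"
    using comm[OF x] f x by (rule pow_mult_distrib)
  ultimately have "(f \<otimes> x) [^] n = f [^] (n - 1) \<otimes> f \<otimes> e"
    by (simp only: e_def)
  also have "\<dots> = \<zero>" using f e by (simp add: m_assoc fe)
  finally have "nilp R (f \<otimes> x)" by (auto simp: nilp_def)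
  then show ?thesis using that n comm by (simp add: f_def e_def)
qed

lemma duo_not_reflexive_imp_zero_prod:
  assumes duo: "right_duo R" "left_duo R" and "\<not> reflexive_ring R"
  obtains a b where "a \<in> carrier R" "b \<in> carrier R" "a \<otimes> b = \<zero>" "b \<otimes> a \<noteq> \<zero>"
proof -
  obtain a b r where *: "a \<in> carrier R" "b \<in> carrier R" "r \<in> carrier R"
    "\<forall>r\<in>carrier R. a \<otimes> r \<otimes> b = \<zero>" "b \<otimes> r \<otimes> a \<noteq> \<zero>"
    using assms(3) ring_axioms unfolding reflexive_ring_def by blast
  obtain s where s: "s \<in> carrier R" "r \<otimes> a = a \<otimes> s"
    using duo(1) *(1,3) unfolding right_duo_def l_coset_def by blast
  have "b \<otimes> r \<otimes> a = b \<otimes> a \<otimes> s" using * s by (simp add: m_assoc)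
  then have "b \<otimes> a \<noteq> \<zero>" using *(5) s(1) by auto
  moreover have "a \<otimes> b = \<zero>" using *(4)[rule_format, of \<one>] *(1) by simp
  ultimately show ?thesis using that *(1,2) by blast
qed

text \<open>Passing to the components \<open>f \<otimes> a\<close> and \<open>g \<otimes> b\<close>
  changes neither product, because \<open>fb = b\<close> and \<open>ag = a\<close>.\<close>

lemma duo_not_reflexive_imp_nilpotent:
  assumes duo: "right_duo R" "left_duo R" and "\<not> reflexive_ring R" and fin: "finite (carrier R)"
  obtains a b where "nilpotent_zero_prod R a b"
proof -
  obtain a b where ab: "a \<in> carrier R" "b \<in> carrier R" "a \<otimes> b = \<zero>" "b \<otimes> a \<noteq> \<zero>"
    using duo_not_reflexive_imp_zero_prod assms(1-3) by blast
  obtain n :: nat and f where n: "n > 0" and f: "f = \<one> \<ominus> a [^] n"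
    and f_comm: "\<And>r. r \<in> carrier R \<Longrightarrow> f \<otimes> r = r \<otimes> f" and f_nilp: "nilp R (f \<otimes> a)"
    using duo_nilpotent_component[OF duo fin ab(1)] by blast
  obtain m :: nat and g where m: "m > 0" and g: "g = \<one> \<ominus> b [^] m"
    and g_comm: "\<And>r. r \<in> carrier R \<Longrightarrow> g \<otimes> r = r \<otimes> g" and g_nilp: "nilp R (g \<otimes> b)"
    using duo_nilpotent_component[OF duo fin ab(2)] by blast
  have closed: "f \<in> carrier R" "g \<in> carrier R" using ab by (simp_all add: f g)
  \<comment> \<open>The exponent is positive, so a factor \<open>a\<close> stands next to
    \<open>b\<close>.\<close>
  have "a [^] n \<otimes> b = \<zero>" using n ab by (cases n) (simp_all add: m_assoc)
  then have fb: "f \<otimes> b = b" using ab by (simp add: f a_minus_def l_distr l_minus)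
  have "b [^] m = b \<otimes> b [^] (m - 1)" using m ab by (cases m) (simp_all add: nat_pow_Suc2[symmetric])
  then have "a \<otimes> b [^] m = \<zero>" using ab by (simp add: m_assoc[symmetric])
  then have ag: "a \<otimes> g = a" using ab by (simp add: g a_minus_def r_distr r_minus)
  have "f \<otimes> a \<otimes> (g \<otimes> b) = f \<otimes> (a \<otimes> g) \<otimes> b" using ab closed by (simp add: m_assoc)
  also have "\<dots> = f \<otimes> (a \<otimes> b)" using ab closed ag by (simp add: m_assoc)
  finally have "f \<otimes> a \<otimes> (g \<otimes> b) = \<zero>" using ab closed by simp
  moreover have "g \<otimes> b \<otimes> (f \<otimes> a) = b \<otimes> a"
  proof -
    have "g \<otimes> b \<otimes> (f \<otimes> a) = g \<otimes> (b \<otimes> f) \<otimes> a" using ab closed by (simp add: m_assoc)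
    also have "\<dots> = g \<otimes> b \<otimes> a" using f_comm[OF ab(2)] fb by simp
    also have "\<dots> = b \<otimes> (a \<otimes> g)" using g_comm[of "b \<otimes> a"] ab closed by (simp add: m_assoc)
    finally show ?thesis by (simp add: ag)
  qed
  ultimately have "nilpotent_zero_prod R (f \<otimes> a) (g \<otimes> b)"
    using ab closed f_nilp g_nilp by unfold_locales simp_all
  then show ?thesis using that by blast
qed

end

text \<open>The nilpotent pair already supplies sixteen distinct elements.\<close>

theorem duo_not_reflexive_order_ge_16:
  assumes "duo_ring R" "\<not> reflexive_ring R" "finite (carrier R)"
  shows "16 \<le> order R"
proof -
  interpret ring R using assms(1) by (simp add: duo_ring_def)
  obtain a b where "nilpotent_zero_prod R a b"
    using duo_not_reflexive_imp_nilpotent assms by (auto simp: duo_ring_def)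
  then interpret nilpotent_zero_prod R a b .
  show ?thesis
    using card_mono[OF assms(3) bit_combs_subset] by (simp add: card_bit_combs order_def)
qed

theorem duo_not_reflexive_order_16:
  fixes R (structure)
  assumes "duo_ring R" "\<not> reflexive_ring R" "order R = 16"
  obtains a b c where "presented R a b c"
proof -
  interpret ring R using assms(1) by (simp add: duo_ring_def)
  have "finite (carrier R)"
    using assms(3) by (intro card_ge_0_finite) (simp add: order_def)
  then obtain a b where "nilpotent_zero_prod R a b"
    using duo_not_reflexive_imp_nilpotent assms by (auto simp: duo_ring_def)
  then interpret nilpotent_zero_prod R a b .
  interpret duo_zero_prod_16 R a b
    using assms by unfold_locales (simp_all add: duo_ring_def)
  obtain c :: int where c: "c \<in> {0..1}" "\<one> \<oplus> \<one> = [c] \<cdot> (b \<otimes> a)" using two_eq by blast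
  have "presented R a b c"
  proof (unfold_locales, fact c(1))
    show "\<one> \<oplus> \<one> = [c] \<cdot> (b \<otimes> a)" by (fact c(2))
    show "a \<otimes> a = b \<otimes> a" by (rule a_square)
    show "b \<otimes> b = b \<otimes> a" by (rule b_square)
    fix x assume "x \<in> carrier R"
    then show "\<exists>n i j k. x = comb R a b n i j k" by (rule bit_comb_cases) blast
  qed
  then show ?thesis using that by blast
qed

section \<open>Free algebras\<close>

definition conv :: "('a, 'm) ring_scheme \<Rightarrow> ('x list \<Rightarrow> 'a) \<Rightarrow> ('x list \<Rightarrow> 'a) \<Rightarrow> 'x list \<Rightarrow> 'a" where
  "conv A f g w = (\<Oplus>\<^bsub>A\<^esub>i\<in>{..length w}. f (take i w) \<otimes>\<^bsub>A\<^esub> g (drop i w))"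

lemma free_algebra_simps:
  "carrier (free_algebra A) = {f. (\<forall>w. f w \<in> carrier A) \<and> finite {w. f w \<noteq> \<zero>\<^bsub>A\<^esub>}}"
  "f \<otimes>\<^bsub>free_algebra A\<^esub> g = conv A f g"
  "\<one>\<^bsub>free_algebra A\<^esub> = (\<lambda>w. if w = [] then \<one>\<^bsub>A\<^esub> else \<zero>\<^bsub>A\<^esub>)"
  "\<zero>\<^bsub>free_algebra A\<^esub> = (\<lambda>w. \<zero>\<^bsub>A\<^esub>)"
  "f \<oplus>\<^bsub>free_algebra A\<^esub> g = (\<lambda>w. f w \<oplus>\<^bsub>A\<^esub> g w)"
  by (simp_all add: free_algebra_def conv_def fun_eq_iff)

context ring
begin

lemma conv_closed [simp]:
  "(\<And>w. f w \<in> carrier R) \<Longrightarrow> (\<And>w. g w \<in> carrier R) \<Longrightarrow> conv R f g w \<in> carrier R"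
  unfolding conv_def by (rule finsum_closed) auto

lemma conv_Nil [simp]:
  "f [] \<in> carrier R \<Longrightarrow> g [] \<in> carrier R \<Longrightarrow> conv R f g [] = f [] \<otimes> g []"
  by (simp add: conv_def)

text \<open>Splits off the factorisation with empty left part; in the others the left part begins
  with \<open>x\<close>, so \<open>f\<close> is replaced by its left derivative at \<open>x\<close>.
  For this reason inductions on words below generalise \<open>f\<close>.\<close>

lemma conv_Cons [simp]:
  assumes "\<And>w. f w \<in> carrier R" "\<And>w. g w \<in> carrier R"
  shows "conv R f g (x # w) = f [] \<otimes> g (x # w) \<oplus> conv R (\<lambda>u. f (x # u)) g w"
proof -
  have "(\<Oplus>i\<in>{..Suc (length w)}. f (take i (x # w)) \<otimes> g (drop i (x # w))) =
      (\<Oplus>i\<in>{..length w}. f (take (Suc i) (x # w)) \<otimes> g (drop (Suc i) (x # w))) \<oplus>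
      f (take 0 (x # w)) \<otimes> g (drop 0 (x # w))"
    by (rule finsum_Suc2) (use assms in auto)
  then have "conv R f g (x # w) = conv R (\<lambda>u. f (x # u)) g w \<oplus> f [] \<otimes> g (x # w)"
    unfolding conv_def by simp
  then show ?thesis using assms by (simp add: a_comm)
qed

lemma conv_zero_left [simp]:
  assumes "\<And>w. g w \<in> carrier R"
  shows "conv R (\<lambda>u. \<zero>) g w = \<zero>"
  by (induction w) (use assms in simp_all)

lemma conv_add_left:
  assumes "\<And>w. f w \<in> carrier R" "\<And>w. g w \<in> carrier R" "\<And>w. h w \<in> carrier R"
  shows "conv R (\<lambda>u. f u \<oplus> g u) h w = conv R f h w \<oplus> conv R g h w"
  using assms by (induction w arbitrary: f g) (simp_all add: l_distr a_ac)

lemma conv_add_right: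
  assumes "\<And>w. f w \<in> carrier R" "\<And>w. g w \<in> carrier R" "\<And>w. h w \<in> carrier R"
  shows "conv R f (\<lambda>u. g u \<oplus> h u) w = conv R f g w \<oplus> conv R f h w"
  using assms by (induction w arbitrary: f) (simp_all add: r_distr a_ac)

lemma conv_scale_left:
  assumes "\<And>w. f w \<in> carrier R" "\<And>w. g w \<in> carrier R" "x \<in> carrier R"
  shows "conv R (\<lambda>u. x \<otimes> f u) g w = x \<otimes> conv R f g w"
  using assms by (induction w arbitrary: f) (simp_all add: r_distr m_assoc)

text \<open>The left derivative of \<open>conv R f g\<close> is a scalar multiple of a derivative of
  \<open>g\<close> plus a convolution covered by the induction hypothesis.\<close>

lemma conv_assoc:
  assumes "\<And>w. f w \<in> carrier R" "\<And>w. g w \<in> carrier R" "\<And>w. h w \<in> carrier R"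
  shows "conv R (conv R f g) h w = conv R f (conv R g h) w"
  using assms
proof (induction w arbitrary: f)
  case Nil
  then show ?case by (simp add: m_assoc)
next
  case (Cons x w)
  have "conv R (conv R f g) h (x # w) = f [] \<otimes> g [] \<otimes> h (x # w) \<oplus>
      conv R (\<lambda>u. f [] \<otimes> g (x # u) \<oplus> conv R (\<lambda>u. f (x # u)) g u) h w"
    using Cons.prems by simp
  also have "\<dots> = f [] \<otimes> g [] \<otimes> h (x # w) \<oplus> (f [] \<otimes> conv R (\<lambda>u. g (x # u)) h w \<oplus>
      conv R (conv R (\<lambda>u. f (x # u)) g) h w)"
    using Cons.prems by (subst conv_add_left) (simp_all add: conv_scale_left)
  also have "\<dots> = f [] \<otimes> conv R g h (x # w) \<oplus> conv R (\<lambda>u. f (x # u)) (conv R g h) w"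
    using Cons.prems by (simp add: Cons.IH r_distr m_assoc a_assoc)
  also have "\<dots> = conv R f (conv R g h) (x # w)"
    using Cons.prems by simp
  finally show ?case .
qed

lemma conv_finite_support:
  assumes "\<And>w. f w \<in> carrier R" "\<And>w. g w \<in> carrier R"
    and "finite {w. f w \<noteq> \<zero>}" "finite {w. g w \<noteq> \<zero>}"
  shows "finite {w. conv R f g w \<noteq> \<zero>}"
proof (rule finite_subset)
  show "{w. conv R f g w \<noteq> \<zero>} \<subseteq> (\<lambda>(u, v). u @ v) ` ({w. f w \<noteq> \<zero>} \<times> {w. g w \<noteq> \<zero>})"
  proof
    fix w assume w: "w \<in> {w. conv R f g w \<noteq> \<zero>}"
    have "\<exists>i. f (take i w) \<otimes> g (drop i w) \<noteq> \<zero>"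
    proof (rule ccontr)
      assume "\<not> ?thesis"
      then have "conv R f g w = \<zero>" unfolding conv_def by (intro add.finprod_one_eqI) auto
      then show False using w by simp
    qed
    then obtain i where i: "f (take i w) \<otimes> g (drop i w) \<noteq> \<zero>" by blast
    have "f (take i w) \<noteq> \<zero>"
    proof
      assume "f (take i w) = \<zero>"
      then show False using i assms(2) by simp
    qed
    moreover have "g (drop i w) \<noteq> \<zero>"
    proof
      assume "g (drop i w) = \<zero>"
      then show False using i assms(1) by simp
    qed
    ultimately show "w \<in> (\<lambda>(u, v). u @ v) ` ({w. f w \<noteq> \<zero>} \<times> {w. g w \<noteq> \<zero>})"
      by (intro image_eqI[of _ _ "(take i w, drop i w)"]) simp_all
  qed
qed (use assms(3,4) in simp)

lemma conv_one_left:
  assumes "\<And>w. f w \<in> carrier R"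
  shows "conv R (\<lambda>w. if w = [] then \<one> else \<zero>) f w = f w"
  using assms by (cases w) simp_all

lemma conv_one_right:
  assumes "\<And>w. f w \<in> carrier R"
  shows "conv R f (\<lambda>w. if w = [] then \<one> else \<zero>) w = f w"
  using assms by (induction w arbitrary: f) simp_all

text \<open>A left derivative of a generator is the unit or zero, so multiplying by it prepends a
  letter.\<close>

lemma conv_gen:
  assumes "\<And>w. f w \<in> carrier R"
  shows "conv R (fa_gen R x) f w = (case w of [] \<Rightarrow> \<zero> | y # w' \<Rightarrow> if y = x then f w' else \<zero>)"
proof (cases w)
  case (Cons y w')
  have "(\<lambda>u. fa_gen R x (y # u)) = (if y = x then (\<lambda>w. if w = [] then \<one> else \<zero>) else (\<lambda>u. \<zero>))"
    by (auto simp: fa_gen_def)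
  then show ?thesis using assms Cons by (simp add: fa_gen_def conv_one_left cong: if_cong)
qed (use assms in \<open>simp add: fa_gen_def\<close>)

lemma free_algebra_add_support:
  assumes "finite {w. f w \<noteq> \<zero>}" "finite {w. g w \<noteq> \<zero>}"
  shows "finite {w. f w \<oplus> g w \<noteq> \<zero>}"
  by (rule finite_subset[of _ "{w. f w \<noteq> \<zero>} \<union> {w. g w \<noteq> \<zero>}"]) (use assms in auto)

lemma free_algebra_uminus_closed:
  assumes "f \<in> carrier (free_algebra R)"
  shows "(\<lambda>w. \<ominus> f w) \<in> carrier (free_algebra R)"
proof -
  have "{w. \<ominus> f w \<noteq> \<zero>} \<subseteq> {w. f w \<noteq> \<zero>}" by auto
  then show ?thesis using assms finite_subset by (auto simp: free_algebra_simps)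
qed

theorem free_algebra_ring: "ring (free_algebra R)"
proof (rule ringI)
  show "abelian_group (free_algebra R)"
  proof (rule abelian_groupI)
    fix f assume f: "f \<in> carrier (free_algebra R :: ('x list \<Rightarrow> 'a) ring)"
    show "\<exists>g\<in>carrier (free_algebra R). g \<oplus>\<^bsub>free_algebra R\<^esub> f = \<zero>\<^bsub>free_algebra R\<^esub>"
      using f by (intro bexI[OF _ free_algebra_uminus_closed[OF f]]) (auto simp: free_algebra_simps l_neg)
  qed (auto simp: free_algebra_simps free_algebra_add_support a_ac fun_eq_iff)
  show "monoid (free_algebra R)"
    by (rule monoidI)
      (auto simp: free_algebra_simps conv_finite_support conv_assoc conv_one_left conv_one_right fun_eq_iff)
qed (auto simp: free_algebra_simps conv_add_left conv_add_right fun_eq_iff)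

lemma free_algebra_a_inv:
  fixes f :: "'x list \<Rightarrow> 'a"
  assumes "f \<in> carrier (free_algebra R)"
  shows "\<ominus>\<^bsub>free_algebra R\<^esub> f = (\<lambda>w. \<ominus> f w)"
proof -
  interpret F: ring "free_algebra R :: ('x list \<Rightarrow> 'a) ring" by (rule free_algebra_ring)
  show ?thesis
    by (rule F.minus_equality) (use assms free_algebra_uminus_closed[OF assms] in
      \<open>auto simp: free_algebra_simps l_neg fun_eq_iff\<close>)
qed

lemma fa_gen_closed [simp]: "fa_gen R x \<in> carrier (free_algebra R)"
  by (auto simp: free_algebra_simps fa_gen_def)

end

text \<open>Every residue is a sum of copies of \<open>1\<close>, so the words, built by prefixing
  generators to the unit, generate the free algebra additively.\<close>

lemma free_algebra_residue_induct [consumes 2, case_names zero one add gen]: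
  assumes m: "m > 1" and f: "f \<in> carrier (free_algebra (residue_ring m))"
    and P_zero: "P \<zero>\<^bsub>free_algebra (residue_ring m)\<^esub>" and P_one: "P \<one>\<^bsub>free_algebra (residue_ring m)\<^esub>"
    and P_add: "\<And>f g. f \<in> carrier (free_algebra (residue_ring m)) \<Longrightarrow> g \<in> carrier (free_algebra (residue_ring m)) \<Longrightarrow>
      P f \<Longrightarrow> P g \<Longrightarrow> P (f \<oplus>\<^bsub>free_algebra (residue_ring m)\<^esub> g)"
    and P_gen: "\<And>x f. f \<in> carrier (free_algebra (residue_ring m)) \<Longrightarrow>
      P f \<Longrightarrow> P (fa_gen (residue_ring m) x \<otimes>\<^bsub>free_algebra (residue_ring m)\<^esub> f)"
  shows "P f"
proof -
  define A where "A = residue_ring m"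
  interpret residues m A by unfold_locales (rule m, rule eq_reflection[OF A_def])
  have [simp]: "carrier A = {0..m - 1}" "\<zero>\<^bsub>A\<^esub> = 0" "\<one>\<^bsub>A\<^esub> = 1" "x \<oplus>\<^bsub>A\<^esub> y = (x + y) mod m" for x y
    by (simp_all add: A_def residue_ring_def)
  define mono where "mono n w = (\<lambda>w'. if w' = w then n else 0 :: int)" for n and w :: "'a list"
  have mono_closed: "mono n w \<in> carrier (free_algebra A)" if "n \<in> {0..m - 1}" for n w
    using that m by (auto simp: free_algebra_simps mono_def)
  have mono_1: "P (mono 1 w)" for w
  proof (induction w)
    case Nil
    then show ?case using P_one by (simp add: free_algebra_simps mono_def A_def[symmetric] cong: if_cong)
  next
    case (Cons x w)
    have closed: "mono 1 w u \<in> carrier A" for u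
      using mono_closed[of 1 w] m by (simp add: free_algebra_simps)
    have "mono 1 (x # w) = fa_gen A x \<otimes>\<^bsub>free_algebra A\<^esub> mono 1 w"
      unfolding free_algebra_simps fun_eq_iff conv_gen[OF closed]
      by (auto simp: mono_def split: list.splits)
    then show ?case using P_gen[of "mono 1 w" x] Cons mono_closed[of 1 w] m by (simp add: A_def)
  qed
  \<comment> \<open>The coefficient is reached by counting up from zero; the bound prevents wrapping
    around.\<close>
  have mono: "P (mono (int n) w)" if "int n < m" for n w
    using that
  proof (induction n)
    case 0
    then show ?case using P_zero by (simp add: free_algebra_simps mono_def A_def[symmetric] cong: if_cong)
  next
    case (Suc n)
    have "mono (int (Suc n)) w = mono (int n) w \<oplus>\<^bsub>free_algebra A\<^esub> mono 1 w"
      using Suc.prems m by (auto simp: free_algebra_simps mono_def fun_eq_iff)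
    then show ?case
      using P_add[of "mono (int n) w" "mono 1 w"] mono_closed[of "int n" w] mono_closed[of 1 w] Suc m mono_1
      by (simp add: A_def)
  qed
  \<comment> \<open>Inducting over a finite set that contains the support allows one word to be
    cleared at a time.\<close>
  have "P f" if "f \<in> carrier (free_algebra A)" "{w. f w \<noteq> 0} \<subseteq> S" "finite S" for S and f :: "'a list \<Rightarrow> int"
    using that(3,1,2)
  proof (induction S arbitrary: f rule: finite_induct)
    case empty
    then have "f = \<zero>\<^bsub>free_algebra A\<^esub>" by (auto simp: free_algebra_simps)
    then show ?case using P_zero by (simp add: A_def)
  next
    case (insert w S)
    have f_range: "f u \<in> {0..m - 1}" for u
      using insert.prems(1) by (simp add: free_algebra_simps)
    have f_mod: "f u mod m = f u" for u
      using f_range[of u] unfolding atLeastAtMost_iff by (intro mod_pos_pos_trivial) linarith+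
    define g where "g = (\<lambda>u. if u = w then 0 else f u)"
    have supp: "{u. g u \<noteq> 0} \<subseteq> S"
      using insert.prems(2) by (auto simp: g_def)
    have "g u \<in> {0..m - 1}" for u
      using f_range[of u] m by (simp add: g_def)
    then have g: "g \<in> carrier (free_algebra A)"
      using finite_subset[OF supp insert.hyps(1)] by (simp add: free_algebra_simps)
    have Pg: "P g" by (rule insert.IH[OF g supp])
    have Pw: "P (mono (f w) w)" using mono[of "nat (f w)" w] f_range[of w] by simp
    have f_eq: "f = g \<oplus>\<^bsub>free_algebra A\<^esub> mono (f w) w"
      by (simp add: free_algebra_simps mono_def g_def fun_eq_iff f_mod)
    show ?case
      by (subst f_eq) (rule P_add[folded A_def, OF g mono_closed[OF f_range] Pg Pw])
  qed
  then show ?thesis using f by (auto simp: free_algebra_simps A_def[symmetric])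
qed

section \<open>The two quotients\<close>

text \<open>The modulus is even, and the parity of \<open>n div 2\<close> matters only for
  \<open>c = 1\<close>, where it is \<open>4\<close>. The last entry is a sum of three because word
  coefficients are reduced separately.\<close>

lemma comb_null_mod:
  assumes "c \<in> {0..1}" and m: "m = 2 + 2 * c"
  shows "comb_null c (n mod m) (i mod m) (j mod m) (x mod m + y mod m + z mod m) \<longleftrightarrow>
    comb_null c n i j (x + y + z)"
proof -
  have c: "c = 0 \<or> c = 1" using assms(1) by auto
  have even_mod: "even (t mod m) \<longleftrightarrow> even t" for t
    using c unfolding m by (elim disjE; simp; presburger)
  have even_mod_div: "even (c * (n mod m div 2)) \<longleftrightarrow> even (c * (n div 2))"
    using c unfolding m by (elim disjE; simp; presburger)
  show ?thesis
    by (simp only: comb_null_def even_add even_mod even_mod_div)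
qed

lemma comb_null_add:
  assumes "comb_null c n i j k" "comb_null c n' i' j' k'"
  shows "comb_null c (n + n') (i + i') (j + j') (k + k')"
proof -
  obtain p p' where "n = 2 * p" "n' = 2 * p'"
    using assms by (auto simp: comb_null_def elim!: evenE)
  then have half: "n div 2 = p" "n' div 2 = p'" "(n + n') div 2 = p + p'" by presburger+
  have "even ((k + c * p) + (k' + c * p'))"
    using assms unfolding comb_null_def half by simp
  then have "even (k + k' + c * (p + p'))"
    by (simp only: algebra_simps)
  then show ?thesis using assms unfolding comb_null_def half by simp
qed

lemma comb_null_uminus:
  assumes "comb_null c n i j k"
  shows "comb_null c (- n) (- i) (- j) (- k)"
proof -
  obtain p where "n = 2 * p"
    using assms by (auto simp: comb_null_def elim!: evenE)
  then have "- n div 2 = - p" "n div 2 = p" by presburger+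
  then show ?thesis using assms by (simp add: comb_null_def)
qed

text \<open>The multipliers \<open>r\<close> and \<open>s\<close> are arbitrary because
  \<open>i\<close> and \<open>j\<close> are even; they stand for linear coefficients of the other
  factor.\<close>

lemma comb_null_mult:
  assumes "comb_null c n i j k"
  shows "comb_null c (n * n') (n * i' + i * n') (n * j' + j * n') (n * k' + k * n' + i * r + j * s)"
    and "comb_null c (n' * n) (n' * i + i' * n) (n' * j + j' * n) (n' * k + k' * n + r * i + s * j)"
proof -
  obtain p where p: "n = 2 * p"
    using assms by (auto simp: comb_null_def elim!: evenE)
  have "even ((k + c * p) * n')" using assms p by (simp add: comb_null_def)
  then have "even (k * n' + c * (p * n'))" by (simp add: algebra_simps)
  then show "comb_null c (n * n') (n * i' + i * n') (n * j' + j * n') (n * k' + k * n' + i * r + j * s)"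
    and "comb_null c (n' * n) (n' * i + i' * n) (n' * j + j' * n) (n' * k + k' * n + r * i + s * j)"
    using assms by (auto simp: comb_null_def p mult.assoc ac_simps)
qed

text \<open>Both quotients at once: \<open>m = 2\<close> for \<open>c = 0\<close> and \<open>m = 4\<close> for \<open>c = 1\<close>.\<close>
locale gen_algebra =
  fixes c m :: int and A :: "int ring" and F :: "(gen list \<Rightarrow> int) ring"
  assumes c_bit: "c \<in> {0..1}" and m_eq: "m = 2 + 2 * c"
    and A_eq: "A = residue_ring m" and F_eq: "F = free_algebra A"
begin

sublocale A: residues m A
  by unfold_locales (use c_bit m_eq in simp, rule eq_reflection[OF A_eq])

sublocale F: ring F
  unfolding F_eq by (rule A.free_algebra_ring)

lemma A_simps:
  "\<zero>\<^bsub>A\<^esub> = 0" "\<one>\<^bsub>A\<^esub> = 1" "x \<oplus>\<^bsub>A\<^esub> y = (x + y) mod m" "x \<otimes>\<^bsub>A\<^esub> y = x * y mod m"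
  by (simp_all add: A_eq residue_ring_def)

lemma A_uminus: "x \<in> carrier A \<Longrightarrow> \<ominus>\<^bsub>A\<^esub> x = (- x) mod m"
  using A.res_neg_eq by (simp add: A_eq)

abbreviation "u \<equiv> fa_gen A U"
abbreviation "v \<equiv> fa_gen A V"

lemma u_closed [simp]: "u \<in> carrier F" and v_closed [simp]: "v \<in> carrier F"
  by (simp_all add: F_eq)

lemma coeff_closed: "f \<in> carrier F \<Longrightarrow> f w \<in> carrier A"
  by (simp add: F_eq free_algebra_simps)

lemma coeff_zero: "\<zero>\<^bsub>F\<^esub> w = 0"
  and coeff_add: "(f \<oplus>\<^bsub>F\<^esub> g) w = (f w + g w) mod m"
  by (simp_all add: F_eq free_algebra_simps A_simps)

lemma coeff_uminus: "f \<in> carrier F \<Longrightarrow> (\<ominus>\<^bsub>F\<^esub> f) w = (- f w) mod m"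
  by (simp add: F_eq A.free_algebra_a_inv A_uminus coeff_closed[unfolded F_eq])

lemma coeff_mult_Nil: "f \<in> carrier F \<Longrightarrow> g \<in> carrier F \<Longrightarrow> (f \<otimes>\<^bsub>F\<^esub> g) [] = (f [] * g []) mod m"
  by (simp add: F_eq free_algebra_simps A_simps)

lemma coeff_mult_single:
  "f \<in> carrier F \<Longrightarrow> g \<in> carrier F \<Longrightarrow> (f \<otimes>\<^bsub>F\<^esub> g) [x] = (f [] * g [x] + f [x] * g []) mod m"
  by (simp add: F_eq free_algebra_simps A_simps mod_simps)

lemma coeff_mult_pair:
  "f \<in> carrier F \<Longrightarrow> g \<in> carrier F \<Longrightarrow>
    (f \<otimes>\<^bsub>F\<^esub> g) [x, y] = (f [] * g [x, y] + f [x] * g [y] + f [x, y] * g []) mod m"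
  by (simp add: F_eq free_algebra_simps A_simps mod_simps add.assoc)

lemma coeff_gen_mult:
  "f \<in> carrier F \<Longrightarrow>
    (fa_gen A x \<otimes>\<^bsub>F\<^esub> f) w = (case w of [] \<Rightarrow> 0 | y # w' \<Rightarrow> if y = x then f w' else 0)"
  by (simp add: F_eq free_algebra_simps A.conv_gen A_simps split: list.split)

lemma coeff_gen: "fa_gen A x w = (if w = [x] then 1 else 0)"
  by (simp add: fa_gen_def A_simps)

text \<open>The kernel of the map to the sixteen-element ring sending \<open>u\<^sup>2\<close>, \<open>uv\<close>, \<open>v\<^sup>2\<close> to the same element and
  killing \<open>vu\<close> and all words of length at least three.\<close>
definition null_ideal :: "(gen list \<Rightarrow> int) set" where
  "null_ideal = {f \<in> carrier F. comb_null c (f []) (f [U]) (f [V]) (f [U, U] + f [U, V] + f [V, V])}"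

lemmas null_mod = comb_null_mod[OF c_bit m_eq]

text \<open>The axioms reduce to closure properties of \<open>comb_null\<close>, with
  \<open>null_mod\<close> removing the reductions modulo \<open>m\<close>.\<close>

lemma null_ideal_ideal: "ideal null_ideal F"
proof (rule idealI[OF F.ring_axioms])
  show "subgroup null_ideal (add_monoid F)"
  proof (rule F.add.subgroupI)
    show "null_ideal \<subseteq> carrier F" by (auto simp: null_ideal_def)
    have "\<zero>\<^bsub>F\<^esub> \<in> null_ideal" by (simp add: null_ideal_def coeff_zero comb_null_def)
    then show "null_ideal \<noteq> {}" by blast
  next
    fix f assume f: "f \<in> null_ideal"
    then have "comb_null c (- f []) (- f [U]) (- f [V]) (- f [U, U] + - f [U, V] + - f [V, V])"
      unfolding minus_add_distrib[symmetric] by (intro comb_null_uminus) (simp add: null_ideal_def)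
    then show "\<ominus>\<^bsub>F\<^esub> f \<in> null_ideal"
      using f by (simp only: null_ideal_def mem_Collect_eq F.a_inv_closed coeff_uminus null_mod simp_thms)
  next
    fix f g assume f: "f \<in> null_ideal" and g: "g \<in> null_ideal"
    have "comb_null c (f [] + g []) (f [U] + g [U]) (f [V] + g [V])
        ((f [U, U] + f [U, V] + f [V, V]) + (g [U, U] + g [U, V] + g [V, V]))"
      by (intro comb_null_add) (use f g in \<open>simp_all add: null_ideal_def\<close>)
    also have "(f [U, U] + f [U, V] + f [V, V]) + (g [U, U] + g [U, V] + g [V, V]) =
        (f [U, U] + g [U, U]) + (f [U, V] + g [U, V]) + (f [V, V] + g [V, V])" by simp
    finally show "f \<oplus>\<^bsub>F\<^esub> g \<in> null_ideal"
      using f g by (simp only: null_ideal_def mem_Collect_eq F.a_closed coeff_add null_mod simp_thms)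
  qed
next
  fix f g assume "f \<in> null_ideal" and g: "g \<in> carrier F"
  then have f: "f \<in> carrier F" "comb_null c (f []) (f [U]) (f [V]) (f [U, U] + f [U, V] + f [V, V])"
    by (simp_all add: null_ideal_def)
  let ?k = "\<lambda>f. f [U, U] + f [U, V] + f [V, V]"
  \<comment> \<open>Only the product belonging to \<open>[V, U]\<close> is missing, so
    \<open>f [U]\<close> meets \<open>g [U]\<close> while \<open>f [V]\<close> meets
    \<open>g [U] + g [V]\<close>.\<close>
  have "comb_null c (g [] * f []) (g [] * f [U] + g [U] * f []) (g [] * f [V] + g [V] * f [])
      (g [] * ?k f + ?k g * f [] + g [U] * f [U] + (g [U] + g [V]) * f [V])"
    using f(2) by (rule comb_null_mult)
  also have "g [] * ?k f + ?k g * f [] + g [U] * f [U] + (g [U] + g [V]) * f [V] =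
      (g [] * f [U, U] + g [U] * f [U] + g [U, U] * f []) + (g [] * f [U, V] + g [U] * f [V] + g [U, V] * f [])
      + (g [] * f [V, V] + g [V] * f [V] + g [V, V] * f [])"
    by (simp add: algebra_simps)
  finally show "g \<otimes>\<^bsub>F\<^esub> f \<in> null_ideal"
    using f(1) g by (simp only: null_ideal_def mem_Collect_eq F.m_closed coeff_mult_Nil coeff_mult_single
        coeff_mult_pair null_mod simp_thms)
  have "comb_null c (f [] * g []) (f [] * g [U] + f [U] * g []) (f [] * g [V] + f [V] * g [])
      (f [] * ?k g + ?k f * g [] + f [U] * (g [U] + g [V]) + f [V] * g [V])"
    using f(2) by (rule comb_null_mult)
  also have "f [] * ?k g + ?k f * g [] + f [U] * (g [U] + g [V]) + f [V] * g [V] =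
      (f [] * g [U, U] + f [U] * g [U] + f [U, U] * g []) + (f [] * g [U, V] + f [U] * g [V] + f [U, V] * g [])
      + (f [] * g [V, V] + f [V] * g [V] + f [V, V] * g [])"
    by (simp add: algebra_simps)
  finally show "f \<otimes>\<^bsub>F\<^esub> g \<in> null_ideal"
    using f(1) g by (simp only: null_ideal_def mem_Collect_eq F.m_closed coeff_mult_Nil coeff_mult_single
        coeff_mult_pair null_mod simp_thms)
qed

lemma uv_notin_null_ideal: "u \<otimes>\<^bsub>F\<^esub> v \<notin> null_ideal"
  by (simp add: null_ideal_def coeff_gen_mult coeff_gen comb_null_def)

text \<open>Here \<open>v\<close> plays the role of \<open>a\<close> and \<open>u\<close> that of
  \<open>b\<close>, since \<open>vu\<close> dies and \<open>uv\<close> survives. The ideal is kept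
  general to cover both presentations.\<close>

lemma presented_quotient:
  assumes I: "ideal I F" and uv: "u \<otimes>\<^bsub>F\<^esub> v \<notin> I"
    and vu: "v \<otimes>\<^bsub>F\<^esub> u \<in> I"
    and uu: "u \<otimes>\<^bsub>F\<^esub> u \<ominus>\<^bsub>F\<^esub> u \<otimes>\<^bsub>F\<^esub> v \<in> I"
    and vv: "v \<otimes>\<^bsub>F\<^esub> v \<ominus>\<^bsub>F\<^esub> u \<otimes>\<^bsub>F\<^esub> v \<in> I"
    and two: "\<one>\<^bsub>F\<^esub> \<oplus>\<^bsub>F\<^esub> \<one>\<^bsub>F\<^esub> \<ominus>\<^bsub>F\<^esub> [c] \<cdot>\<^bsub>F\<^esub> (u \<otimes>\<^bsub>F\<^esub> v) \<in> I"
  shows "presented (F Quot I) (I +>\<^bsub>F\<^esub> v) (I +>\<^bsub>F\<^esub> u) c"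
proof -
  interpret I: ideal I F by (rule I)
  interpret Q: ring "F Quot I" by (rule I.quotient_is_ring)
  interpret proj: ring_hom_ring F "F Quot I" "(+>\<^bsub>F\<^esub>) I" by (rule I.rcos_ring_hom_ring)
  define a where "a = I +>\<^bsub>F\<^esub> v"
  define b where "b = I +>\<^bsub>F\<^esub> u"
  have proj_eq: "I +>\<^bsub>F\<^esub> x = I +>\<^bsub>F\<^esub> y" if "x \<ominus>\<^bsub>F\<^esub> y \<in> I" "x \<in> carrier F" "y \<in> carrier F" for x y
    using F.quotient_eq_iff_same_a_r_cos[OF I that(2,3)] that(1) by (rule iffD1)
  have proj_zero: "I +>\<^bsub>F\<^esub> x = \<zero>\<^bsub>F Quot I\<^esub> \<longleftrightarrow> x \<in> I" if "x \<in> carrier F" for x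
  proof -
    have zero: "\<zero>\<^bsub>F Quot I\<^esub> = I" by (simp only: FactRing_def ring_record_simps)
    show ?thesis
      unfolding zero by (rule iffI, erule I.rcos_const_imp_mem[OF that], erule I.a_rcos_const)
  qed
  have closed: "a \<in> carrier (F Quot I)" "b \<in> carrier (F Quot I)" by (simp_all add: a_def b_def)
  have ba: "b \<otimes>\<^bsub>F Quot I\<^esub> a = I +>\<^bsub>F\<^esub> (u \<otimes>\<^bsub>F\<^esub> v)" by (simp add: a_def b_def)
  interpret presented_relations "F Quot I" a b c
  proof
    show "a \<otimes>\<^bsub>F Quot I\<^esub> b = \<zero>\<^bsub>F Quot I\<^esub>"
      using proj_zero[of "v \<otimes>\<^bsub>F\<^esub> u"] vu by (simp add: a_def b_def)
    show "b \<otimes>\<^bsub>F Quot I\<^esub> a \<noteq> \<zero>\<^bsub>F Quot I\<^esub>"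
      unfolding ba using proj_zero[of "u \<otimes>\<^bsub>F\<^esub> v"] uv by simp
    show "a \<otimes>\<^bsub>F Quot I\<^esub> a = b \<otimes>\<^bsub>F Quot I\<^esub> a"
      unfolding ba using proj_eq[OF vv] by (simp add: a_def)
    show "b \<otimes>\<^bsub>F Quot I\<^esub> b = b \<otimes>\<^bsub>F Quot I\<^esub> a"
      unfolding ba using proj_eq[OF uu] by (simp add: b_def)
    have c: "c = 0 \<or> c = 1" using c_bit by auto
    have "I +>\<^bsub>F\<^esub> ([c] \<cdot>\<^bsub>F\<^esub> (u \<otimes>\<^bsub>F\<^esub> v)) = [c] \<cdot>\<^bsub>F Quot I\<^esub> (I +>\<^bsub>F\<^esub> (u \<otimes>\<^bsub>F\<^esub> v))"
      using c by (elim disjE) simp_all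
    then show "\<one>\<^bsub>F Quot I\<^esub> \<oplus>\<^bsub>F Quot I\<^esub> \<one>\<^bsub>F Quot I\<^esub> = [c] \<cdot>\<^bsub>F Quot I\<^esub> (b \<otimes>\<^bsub>F Quot I\<^esub> a)"
      unfolding ba using proj_eq[OF two] by simp
  qed (use closed c_bit in simp_all)
  have gen_comb: "I +>\<^bsub>F\<^esub> fa_gen A x = (case x of U \<Rightarrow> comb (F Quot I) a b 0 0 1 0 | V \<Rightarrow> comb (F Quot I) a b 0 1 0 0)" for x
    using closed by (cases x) (simp_all add: comb_def a_def b_def)
  \<comment> \<open>The multiplication table shows that combinations are closed under left
    multiplication by generators, as the induction requires.\<close>
  have span: "\<exists>n i j k. I +>\<^bsub>F\<^esub> f = comb (F Quot I) a b n i j k" if "f \<in> carrier F" for f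
    using A.m_gt_one that unfolding F_eq A_eq
  proof (induction rule: free_algebra_residue_induct)
    case zero
    have "I +>\<^bsub>F\<^esub> \<zero>\<^bsub>F\<^esub> = comb (F Quot I) a b 0 0 0 0" by (simp add: comb_def)
    then show ?case unfolding F_eq A_eq by blast
  next
    case one
    have "I +>\<^bsub>F\<^esub> \<one>\<^bsub>F\<^esub> = comb (F Quot I) a b 1 0 0 0" by (simp add: comb_def)
    then show ?case unfolding F_eq A_eq by blast
  next
    case (add f g)
    note add = add[folded A_eq, folded F_eq]
    then obtain n i j k n' i' j' k' where "I +>\<^bsub>F\<^esub> f = comb (F Quot I) a b n i j k"
      "I +>\<^bsub>F\<^esub> g = comb (F Quot I) a b n' i' j' k'" by blast
    then have "I +>\<^bsub>F\<^esub> (f \<oplus>\<^bsub>F\<^esub> g) = comb (F Quot I) a b (n + n') (i + i') (j + j') (k + k')"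
      using proj.hom_add[OF add(1,2)] Q.comb_add[OF closed] by simp
    then show ?case unfolding F_eq A_eq by blast
  next
    case (gen x f)
    note gen = gen[folded A_eq, folded F_eq]
    then obtain n i j k where f: "I +>\<^bsub>F\<^esub> f = comb (F Quot I) a b n i j k" by blast
    have "I +>\<^bsub>F\<^esub> (fa_gen A x \<otimes>\<^bsub>F\<^esub> f) = (I +>\<^bsub>F\<^esub> fa_gen A x) \<otimes>\<^bsub>F Quot I\<^esub> (I +>\<^bsub>F\<^esub> f)"
      using gen(1) by (intro proj.hom_mult) (simp_all add: F_eq)
    also have "\<exists>n i j k. \<dots> = comb (F Quot I) a b n i j k"
      unfolding f gen_comb by (cases x) (auto simp: comb_mult)
    finally show ?case unfolding F_eq A_eq .
  qed
  have "presented (F Quot I) a b c"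
  proof unfold_locales
    fix x assume "x \<in> carrier (F Quot I)"
    then have "x \<in> a_rcosets\<^bsub>F\<^esub> I" by (simp only: FactRing_def partial_object.simps)
    then obtain f where "f \<in> carrier F" "x = I +>\<^bsub>F\<^esub> f" unfolding A_RCOSETS_def' by blast
    then show "\<exists>n i j k. x = comb (F Quot I) a b n i j k" using span by blast
  qed
  then show ?thesis by (simp only: a_def b_def)
qed

end

section \<open>The two presentations and the classification\<close>

lemma presented_ring_i: "\<exists>a b. presented ring_i a b 0"
proof -
  define A where "A = residue_ring 2"
  define F :: "(gen list \<Rightarrow> int) ring" where "F = free_algebra A"
  interpret gen_algebra 0 2 A F by unfold_locales (simp_all add: A_def F_def)
  define S where "S = {u [^]\<^bsub>F\<^esub> (3::nat), v [^]\<^bsub>F\<^esub> (3::nat), v \<otimes>\<^bsub>F\<^esub> u,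
    u [^]\<^bsub>F\<^esub> (2::nat) \<ominus>\<^bsub>F\<^esub> u \<otimes>\<^bsub>F\<^esub> v, v [^]\<^bsub>F\<^esub> (2::nat) \<ominus>\<^bsub>F\<^esub> u \<otimes>\<^bsub>F\<^esub> v}"
  have pow: "x [^]\<^bsub>F\<^esub> (2::nat) = x \<otimes>\<^bsub>F\<^esub> x" "x [^]\<^bsub>F\<^esub> (3::nat) = x \<otimes>\<^bsub>F\<^esub> (x \<otimes>\<^bsub>F\<^esub> x)" if "x \<in> carrier F" for x
    using that by (simp_all add: numeral_eq_Suc F.m_assoc)
  have S: "S \<subseteq> carrier F" by (simp add: S_def)
  \<comment> \<open>The relators lie in the explicit ideal, so the ideal that they generate also
    misses \<open>uv\<close>.\<close>
  have "S \<subseteq> null_ideal"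
    by (simp add: S_def null_ideal_def pow a_minus_def coeff_add coeff_uminus coeff_gen_mult coeff_gen comb_null_def)
  then have "Idl\<^bsub>F\<^esub> S \<subseteq> null_ideal" by (rule F.genideal_minimal[OF null_ideal_ideal])
  then have uv: "u \<otimes>\<^bsub>F\<^esub> v \<notin> Idl\<^bsub>F\<^esub> S" using uv_notin_null_ideal by blast
  have ideal: "ideal (Idl\<^bsub>F\<^esub> S) F" by (rule F.genideal_ideal[OF S])
  \<comment> \<open>Over residues modulo \<open>2\<close> the sum of two units is already
    zero.\<close>
  have "\<one>\<^bsub>F\<^esub> \<oplus>\<^bsub>F\<^esub> \<one>\<^bsub>F\<^esub> \<ominus>\<^bsub>F\<^esub> [(0::int)] \<cdot>\<^bsub>F\<^esub> (u \<otimes>\<^bsub>F\<^esub> v) = \<zero>\<^bsub>F\<^esub>"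
    by (simp add: a_minus_def) (auto simp: F_def A_def free_algebra_simps residue_ring_def)
  then have two: "\<one>\<^bsub>F\<^esub> \<oplus>\<^bsub>F\<^esub> \<one>\<^bsub>F\<^esub> \<ominus>\<^bsub>F\<^esub> [(0::int)] \<cdot>\<^bsub>F\<^esub> (u \<otimes>\<^bsub>F\<^esub> v) \<in> Idl\<^bsub>F\<^esub> S"
    by (simp only: additive_subgroup.zero_closed[OF ideal.axioms(1)[OF ideal]])
  have gens: "x \<in> Idl\<^bsub>F\<^esub> S" if "x \<in> S" for x
    using F.genideal_self[OF S] that by blast
  have "presented (F Quot Idl\<^bsub>F\<^esub> S) (Idl\<^bsub>F\<^esub> S +>\<^bsub>F\<^esub> v) (Idl\<^bsub>F\<^esub> S +>\<^bsub>F\<^esub> u) 0"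
    by (rule presented_quotient[OF ideal uv gens gens gens two]) (simp_all add: S_def pow)
  then show ?thesis unfolding ring_i_def Let_def S_def F_def A_def by blast
qed

lemma presented_ring_ii: "\<exists>a b. presented ring_ii a b 1"
proof -
  define A where "A = residue_ring 4"
  define F :: "(gen list \<Rightarrow> int) ring" where "F = free_algebra A"
  interpret gen_algebra 1 4 A F by unfold_locales (simp_all add: A_def F_def)
  define two where "two = (fa_const A 2 :: gen list \<Rightarrow> int)"
  define S where "S = {u [^]\<^bsub>F\<^esub> (3::nat), v [^]\<^bsub>F\<^esub> (3::nat), v \<otimes>\<^bsub>F\<^esub> u,
    u [^]\<^bsub>F\<^esub> (2::nat) \<ominus>\<^bsub>F\<^esub> u \<otimes>\<^bsub>F\<^esub> v, v [^]\<^bsub>F\<^esub> (2::nat) \<ominus>\<^bsub>F\<^esub> u \<otimes>\<^bsub>F\<^esub> v,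
    two \<ominus>\<^bsub>F\<^esub> u \<otimes>\<^bsub>F\<^esub> v, two \<otimes>\<^bsub>F\<^esub> u, two \<otimes>\<^bsub>F\<^esub> v}"
  have pow: "x [^]\<^bsub>F\<^esub> (2::nat) = x \<otimes>\<^bsub>F\<^esub> x" "x [^]\<^bsub>F\<^esub> (3::nat) = x \<otimes>\<^bsub>F\<^esub> (x \<otimes>\<^bsub>F\<^esub> x)" if "x \<in> carrier F" for x
    using that by (simp_all add: numeral_eq_Suc F.m_assoc)
  \<comment> \<open>Brings the relator \<open>2 - uv\<close> into the form that
    \<open>presented_quotient\<close> expects for \<open>c = 1\<close>.\<close>
  have two: "two = \<one>\<^bsub>F\<^esub> \<oplus>\<^bsub>F\<^esub> \<one>\<^bsub>F\<^esub>"
    by (auto simp: two_def fa_const_def F_def A_def free_algebra_simps residue_ring_def)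
  have coeff_two: "two w = (if w = [] then 2 else 0)" for w
    by (simp add: two_def fa_const_def A_def residue_ring_def)
  have two_closed [simp]: "two \<in> carrier F" by (simp add: two)
  have S: "S \<subseteq> carrier F" by (simp add: S_def)
  have "S \<subseteq> null_ideal"
    by (simp add: S_def null_ideal_def pow a_minus_def coeff_add coeff_uminus coeff_gen_mult coeff_gen comb_null_def
        coeff_two coeff_mult_Nil coeff_mult_single coeff_mult_pair)
  then have "Idl\<^bsub>F\<^esub> S \<subseteq> null_ideal" by (rule F.genideal_minimal[OF null_ideal_ideal])
  then have uv: "u \<otimes>\<^bsub>F\<^esub> v \<notin> Idl\<^bsub>F\<^esub> S" using uv_notin_null_ideal by blast
  have gens: "x \<in> Idl\<^bsub>F\<^esub> S" if "x \<in> S" for x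
    using F.genideal_self[OF S] that by blast
  have "presented (F Quot Idl\<^bsub>F\<^esub> S) (Idl\<^bsub>F\<^esub> S +>\<^bsub>F\<^esub> v) (Idl\<^bsub>F\<^esub> S +>\<^bsub>F\<^esub> u) 1"
    by (rule presented_quotient[OF F.genideal_ideal[OF S] uv gens gens gens gens])
      (simp_all add: S_def pow two[symmetric])
  then show ?thesis unfolding ring_ii_def Let_def S_def F_def A_def two_def by blast
qed

theorem theorem3p1:
  shows
    "(\<forall>R :: ('a, 'b) ring_scheme.
        duo_ring R \<and> \<not> reflexive_ring R \<and> finite (carrier R) \<longrightarrow> 16 \<le> order R) \<and>
     (duo_ring ring_i \<and> \<not> reflexive_ring ring_i \<and> order ring_i = 16) \<and>
     (duo_ring ring_ii \<and> \<not> reflexive_ring ring_ii \<and> order ring_ii = 16) \<and>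
     \<not> ring_i \<simeq> ring_ii \<and>
     (\<forall>R :: ('a, 'b) ring_scheme.
        duo_ring R \<and> \<not> reflexive_ring R \<and> order R = 16 \<longrightarrow> R \<simeq> ring_i \<or> R \<simeq> ring_ii)"
proof -
  obtain a b where i: "presented ring_i a b 0" using presented_ring_i by blast
  obtain a' b' where ii: "presented ring_ii a' b' 1" using presented_ring_ii by blast
  interpret i: presented ring_i a b 0 by (rule i)
  interpret ii: presented ring_ii a' b' 1 by (rule ii)
  \<comment> \<open>The characteristic separates them: twice unity is zero in \<open>ring_i\<close>
    but equals the nonzero \<open>ba\<close> in \<open>ring_ii\<close>.\<close>
  have "\<not> ring_i \<simeq> ring_ii"
  proof
    assume "ring_i \<simeq> ring_ii"
    then obtain h where h: "h \<in> ring_iso ring_i ring_ii" by (auto simp: is_ring_iso_def)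
    then interpret ring_hom_ring ring_i ring_ii h
      by (intro ring_hom_ringI2) (auto simp: ring_iso_def i.ring_axioms ii.ring_axioms)
    have "h (\<one>\<^bsub>ring_i\<^esub> \<oplus>\<^bsub>ring_i\<^esub> \<one>\<^bsub>ring_i\<^esub>) = \<zero>\<^bsub>ring_ii\<^esub>" unfolding i.two by simp
    then have "\<one>\<^bsub>ring_ii\<^esub> \<oplus>\<^bsub>ring_ii\<^esub> \<one>\<^bsub>ring_ii\<^esub> = \<zero>\<^bsub>ring_ii\<^esub>" by simp
    then show False using ii.two ii.ba by simp
  qed
  moreover have "R \<simeq> ring_i \<or> R \<simeq> ring_ii"
    if R: "duo_ring R" "\<not> reflexive_ring R" "order R = 16" for R :: "('a, 'b) ring_scheme"
  proof -
    obtain x y c where p: "presented R x y c" using duo_not_reflexive_order_16[OF R] by blast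
    then interpret presented R x y c .
    have "c = 0 \<or> c = 1" using c_bit by auto
    then show ?thesis
    proof
      assume "c = 0"
      then have "presented R x y 0" using p by simp
      from presented_ring_iso[OF this i] show ?thesis ..
    next
      assume "c = 1"
      then have "presented R x y 1" using p by simp
      from presented_ring_iso[OF this ii] show ?thesis ..
    qed
  qed
  ultimately show ?thesis
    using duo_not_reflexive_order_ge_16 i.is_duo i.not_reflexive i.order_16
      ii.is_duo ii.not_reflexive ii.order_16 by blast
qed

end
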